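(* Let $G = G(m,n,\vec{a},\vec{b})$ be a down-left graph, let $k$ be a field of characteristic zero, let $R$ be the polynomial ring over $k$ whose variables are the vertices of $G$, and let $I(G)\subseteq R$ be the edge ideal of $G$. Then $$\mathrm{reg}(R/I(G)) = \mathrm{im}(G).$$
   Context: All graphs are finite and simple. For positive integers $m,n$, $G(m,n)$ is the graph with vertex set $\{x_{i,j} \mid 1\le i\le m,\ 1\le j\le n\}$ and edge set $\{\{x_{i,j},x_{k,\ell}\} \mid i<k,\ j>\ell\}$. Down-left graphs: let $\vec a=(a_1,\dots,a_m)$ and $\vec b=(b_1,\dots,b_m)$ be vectors in $\mathbb{Z}_{\ge 0}^m$ such that $0=a_1\le a_2\le\cdots\le a_m<n$, $1<b_1\le b_2\le\cdots\le b_{m-1}\le b_m=n+1$, and $a_i<b_i$ for all $2\le i\le m-1$. Let $W=\{x_{i,j}\mid 2\le i\le m,\ 1\le j\le a_i\}$ and $Z=\{x_{i,j}\mid 1\le i\le m-1,\ b_i\le j\le n\}$. The down-left graph $G(m,n,\vec a,\vec b)$ is the induced subgraph of $G(m,n)$ on $V(G(m,n))\setminus(W\cup Z)$ (equivalently, on the vertices $x_{i,j}$ with $a_i<j<b_i$). The edge ideal of a graph $G$ is $I(G)=\langle uv \mid \{u,v\}\in E(G)\rangle\subseteq R$. For a homogeneous ideal $I$ of the standard graded polynomial ring $R$ with graded Betti numbers $\beta_{i,j}(R/I)$ (read off from the minimal graded free resolution $\cdots\to\bigoplus_j R(-j)^{\beta_{1,j}(R/I)}\to R\to R/I\to 0$),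 the Castelnuovo–Mumford regularity is $\mathrm{reg}(R/I)=\max\{j-i\mid\beta_{i,j}(R/I)\ne 0\}$. An induced matching of $G$ is a set of pairwise disjoint edges such that the induced subgraph of $G$ on the set of all their endpoints has no edges other than those in the set. The induced matching number $\mathrm{im}(G)$ is the largest number of edges in an induced matching of $G$ (it is $0$ if $G$ has no edges). *)

theory Defs
  imports Complex_Main "HOL-Library.Poly_Mapping"
begin

section \<open>Graphs and induced matchings\<close>

record 'v graph =
  verts :: "'v set"
  edges :: "'v set set"

definition induced_subgraph :: "'v graph \<Rightarrow> 'v set \<Rightarrow> 'v graph" where
  "induced_subgraph G U = \<lparr>verts = verts G \<inter> U, edges = {e \<in> edges G. e \<subseteq> U}\<rparr>"

definition induced_matching :: "'v graph \<Rightarrow> 'v set set \<Rightarrow> bool" where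
  "induced_matching G M \<longleftrightarrow>
     M \<subseteq> edges G \<and> pairwise disjnt M \<and> edges (induced_subgraph G (\<Union>M)) \<subseteq> M"

definition induced_matching_number :: "'v graph \<Rightarrow> nat" where
  "induced_matching_number G = Max {card M | M. induced_matching G M}"


section \<open>Down-left graphs\<close>

text \<open>The pair \<open>(i, j)\<close> stands for the vertex \<open>x_{i,j}\<close>.\<close>

definition full_graph :: "nat \<Rightarrow> nat \<Rightarrow> (nat \<times> nat) graph" where
  "full_graph m n =
     \<lparr>verts = {1..m} \<times> {1..n},
      edges = {{(i, j), (k, l)} | i j k l.
                 i \<in> {1..m} \<and> k \<in> {1..m} \<and> j \<in> {1..n} \<and> l \<in> {1..n} \<and> i < k \<and> j > l}\<rparr>"

text \<open>A vector \<open>(a_1, \<dots>, a_m)\<close> is a function whose values outside \<open>{1..m}\<close> are irrelevant.\<close>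

definition down_left_data :: "nat \<Rightarrow> nat \<Rightarrow> (nat \<Rightarrow> nat) \<Rightarrow> (nat \<Rightarrow> nat) \<Rightarrow> bool" where
  "down_left_data m n a b \<longleftrightarrow>
     1 \<le> m \<and> 1 \<le> n \<and>
     a 1 = 0 \<and> (\<forall>i. 1 \<le> i \<and> i < m \<longrightarrow> a i \<le> a (i + 1)) \<and> a m < n \<and>
     1 < b 1 \<and> (\<forall>i. 1 \<le> i \<and> i < m \<longrightarrow> b i \<le> b (i + 1)) \<and> b m = n + 1 \<and>
     (\<forall>i. 2 \<le> i \<and> i < m \<longrightarrow> a i < b i)"

definition down_left_graph ::
    "nat \<Rightarrow> nat \<Rightarrow> (nat \<Rightarrow> nat) \<Rightarrow> (nat \<Rightarrow> nat) \<Rightarrow> (nat \<times> nat) graph" where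
  "down_left_graph m n a b =
     (let W = {(i, j). 2 \<le> i \<and> i \<le> m \<and> 1 \<le> j \<and> j \<le> a i};
          Z = {(i, j). 1 \<le> i \<and> i < m \<and> b i \<le> j \<and> j \<le> n}
      in induced_subgraph (full_graph m n) (verts (full_graph m n) - (W \<union> Z)))"


section \<open>Polynomial rings and ideals\<close>

text \<open>
  A polynomial is a finitely supported function from monomials to coefficients, and a monomial a
  finitely supported function from variables to exponents. The type contains the polynomials in
  all variables of type \<open>'v\<close>; the ring in the variables \<open>V\<close> is the subset \<open>poly_ring V\<close>.
\<close>

type_synonym ('v, 'k) mpoly = "('v \<Rightarrow>\<^sub>0 nat) \<Rightarrow>\<^sub>0 'k"

definition poly_ring :: "'v set \<Rightarrow> ('v, 'k::field) mpoly set" where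
  "poly_ring V = {p. \<forall>t \<in> Poly_Mapping.keys p. Poly_Mapping.keys t \<subseteq> V}"

definition var :: "'v \<Rightarrow> ('v, 'k::field) mpoly" where
  "var v = Poly_Mapping.single (Poly_Mapping.single v 1) 1"

definition mon_degree :: "('v \<Rightarrow>\<^sub>0 nat) \<Rightarrow> nat" where
  "mon_degree t = (\<Sum>v \<in> Poly_Mapping.keys t. Poly_Mapping.lookup t v)"

text \<open>The zero polynomial is homogeneous of every degree, and the only one of negative degree.\<close>

definition homogeneous :: "int \<Rightarrow> ('v, 'k::field) mpoly \<Rightarrow> bool" where
  "homogeneous d p \<longleftrightarrow> (\<forall>t \<in> Poly_Mapping.keys p. int (mon_degree t) = d)"

definition ideal_generated ::
    "'v set \<Rightarrow> ('v, 'k::field) mpoly set \<Rightarrow> ('v, 'k) mpoly set" where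
  "ideal_generated V S =
     {\<Sum>s\<in>T. c s * s | T c. finite T \<and> T \<subseteq> S \<and> (\<forall>s\<in>T. c s \<in> poly_ring V)}"

definition edge_ideal :: "'v graph \<Rightarrow> ('v, 'k::field) mpoly set" where
  "edge_ideal G = ideal_generated (verts G) {var u * var v | u v. {u, v} \<in> edges G}"


section \<open>Minimal graded free resolutions and regularity\<close>

text \<open>
  A finitely generated graded free module in each homological degree, with a map between any two
  consecutive ones: \<open>F_i\<close> is the direct sum of \<open>R(- gdeg F i r)\<close> over \<open>r < rank F i\<close>, and
  \<open>entry F i r s\<close> is the coefficient at the \<open>r\<close>-th basis element of \<open>F_i\<close> in the image of the
  \<open>s\<close>-th basis element of \<open>F_{i+1}\<close>. Values at indices not below the ranks are irrelevant.
\<close>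

record (overloaded) ('v, 'k::zero) graded_free_seq =
  rank :: "nat \<Rightarrow> nat"
  gdeg :: "nat \<Rightarrow> nat \<Rightarrow> int"
  entry :: "nat \<Rightarrow> nat \<Rightarrow> nat \<Rightarrow> ('v \<Rightarrow>\<^sub>0 nat) \<Rightarrow>\<^sub>0 'k"

definition free_module ::
    "'v set \<Rightarrow> ('v, 'k::field) graded_free_seq \<Rightarrow> nat \<Rightarrow> (nat \<Rightarrow> ('v, 'k) mpoly) set" where
  "free_module V F i =
     {f. (\<forall>r < rank F i. f r \<in> poly_ring V) \<and> (\<forall>r \<ge> rank F i. f r = 0)}"

text \<open>The map from \<open>F_{i+1}\<close> to \<open>F_i\<close>.\<close>

definition differential ::
    "('v, 'k::field) graded_free_seq \<Rightarrow> nat \<Rightarrow> (nat \<Rightarrow> ('v, 'k) mpoly) \<Rightarrow> nat \<Rightarrow> ('v, 'k) mpoly"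
  where
  "differential F i f =
     (\<lambda>r. if r < rank F i then \<Sum>s < rank F (Suc i). entry F i r s * f s else 0)"

text \<open>
  In a resolution of \<open>R/I\<close> we take \<open>F_0 = R\<close> with the canonical projection as augmentation, so
  exactness at \<open>F_0\<close> says that the image of \<open>F_1\<close> is \<open>I\<close>. Minimality is the condition that each
  differential maps \<open>F_{i+1}\<close> into \<open>\<mm> F_i\<close> for the ideal \<open>\<mm>\<close> generated by the variables, i.e.
  that all matrix entries lie in \<open>\<mm>\<close>.
\<close>

definition minimal_graded_free_resolution ::
    "'v set \<Rightarrow> ('v, 'k::field) mpoly set \<Rightarrow> ('v, 'k) graded_free_seq \<Rightarrow> bool" where
  "minimal_graded_free_resolution V I F \<longleftrightarrow>
     rank F 0 = 1 \<and> gdeg F 0 0 = 0 \<and>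
     (\<forall>i r s. r < rank F i \<and> s < rank F (Suc i) \<longrightarrow>
        entry F i r s \<in> poly_ring V \<and>
        homogeneous (gdeg F (Suc i) s - gdeg F i r) (entry F i r s)) \<and>
     (\<lambda>f. f 0) ` differential F 0 ` free_module V F 1 = I \<and>
     (\<forall>i. differential F (Suc i) ` free_module V F (Suc (Suc i)) =
          {f \<in> free_module V F (Suc i). differential F i f = (\<lambda>r. 0)}) \<and>
     (\<forall>i r s. r < rank F i \<and> s < rank F (Suc i) \<longrightarrow>
        entry F i r s \<in> ideal_generated V (var ` V))"

text \<open>
  For finite \<open>V\<close> and a proper homogeneous ideal \<open>I\<close>, a minimal graded free resolution of \<open>R/I\<close>
  exists and is unique up to isomorphism, so the numbers below do not depend on the choice.
\<close>

definition betti :: "'v set \<Rightarrow> ('v, 'k::field) mpoly set \<Rightarrow> nat \<Rightarrow> int \<Rightarrow> nat" where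
  "betti V I i j =
     (let F = (SOME F. minimal_graded_free_resolution V I F)
      in card {r. r < rank F i \<and> gdeg F i r = j})"

text \<open>The regularity of \<open>R/I\<close>, for \<open>R = poly_ring V\<close>.\<close>

definition regularity :: "'v set \<Rightarrow> ('v, 'k::field) mpoly set \<Rightarrow> int" where
  "regularity V I = Max {j - int i | i j. betti V I i j \<noteq> 0}"

end

theory Submission
  imports Defs
begin

text \<open>
  The strands, in each multidegree, of a multigraded free resolution of a squarefree monomial ideal are
  complexes of vector spaces, so the resolution is encoded by one matrix of scalars whose rows and
  columns carry a homological degree and a label, the support of the multidegree. Given such matrices
  for ideals \<open>J\<close> and \<open>J : u\<close>, with \<open>u\<close> a squarefree monomial, the mapping cone is one for
  \<open>J + (u)\<close>.

  For the upper bound we delete an edge \<open>e\<close> that is not the middle edge of an induced path on four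
  vertices. Then \<open>im(G - e) \<le> im(G)\<close>, while \<open>im(G - N[e]) + 1 \<le> im(G)\<close> always holds, and
  \<open>I(G - e) : e\<close> is generated by \<open>I(G - N[e])\<close> and variables, so the mapping cone gives
  \<open>reg(G) \<le> im(G)\<close> by induction. A class of graphs containing the down-left graphs in which such an edge
  always exists and can be deleted is given by boxes in the plane, two of them being
  adjacent iff one lies strictly to the left of and above the other.

  For the lower bound, restricting a minimal resolution to the vertices of an induced matching with
  \<open>s\<close> edges gives a minimal resolution of the ideal of the matching. By uniqueness it has
  the degrees of the Koszul complex, which has a generator of degree \<open>2s\<close> in homological degree \<open>s\<close>.
\<close>

section \<open>Labelled complexes\<close>

text \<open>Since labels are squarefree, the strand in a multidegree depends only on its support
  \<open>U\<close>: its basis consists of the elements with label inside \<open>U\<close>. Exactness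
  is thus a family of linear algebra statements indexed by sets, and polynomials enter only when a
  complex is turned into a resolution. Mapping cones need not be minimal. But cancellation only
  discards basis elements, so a bound on the size of the label minus the height, which is internal
  minus homological degree, survives the passage to a minimal complex. A cone over a monomial with
  support \<open>m\<close> raises the height by one and the degree by at most \<open>card m\<close>.
  An edge therefore has to be paid for by a drop of one in the induced matching number, while a
  variable costs nothing. Regularity is defined through an arbitrarily chosen resolution, so
  uniqueness of the degrees is needed for the upper bound as well.\<close>

definition mat_vec :: "'b set \<Rightarrow> ('a \<Rightarrow> 'b \<Rightarrow> 'k::comm_ring_1) \<Rightarrow> ('b \<Rightarrow> 'k) \<Rightarrow> 'a \<Rightarrow> 'k" where
  "mat_vec B c f x = (\<Sum>y\<in>B. c x y * f y)"

lemma mat_vec_add: "mat_vec B c (\<lambda>y. f y + g y) x = mat_vec B c f x + mat_vec B c g x"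
  by (simp add: mat_vec_def ring_distribs sum.distrib)

lemma mat_vec_diff: "mat_vec B c (\<lambda>y. f y - g y) x = mat_vec B c f x - mat_vec B c g x"
  by (simp add: mat_vec_def ring_distribs sum_subtractf)

lemma mat_vec_minus: "mat_vec B c (\<lambda>y. - f y) x = - mat_vec B c f x"
  by (simp add: mat_vec_def sum_negf)

lemma mat_vec_scale: "mat_vec B c (\<lambda>y. f y * a) x = mat_vec B c f x * a"
  by (simp add: mat_vec_def sum_distrib_right mult.assoc)

lemma mat_vec_zero [simp]: "mat_vec B c (\<lambda>y. 0) x = 0"
  by (simp add: mat_vec_def)

lemma mat_vec_mat_vec: "mat_vec A c (mat_vec B d f) x = mat_vec B (\<lambda>x z. mat_vec A c (\<lambda>y. d y z) x) f x"
proof -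
  have "mat_vec A c (mat_vec B d f) x = (\<Sum>y\<in>A. \<Sum>z\<in>B. c x y * d y z * f z)"
    by (simp add: mat_vec_def sum_distrib_left mult.assoc)
  also have "\<dots> = (\<Sum>z\<in>B. \<Sum>y\<in>A. c x y * d y z * f z)" by (rule sum.swap)
  also have "\<dots> = mat_vec B (\<lambda>x z. mat_vec A c (\<lambda>y. d y z) x) f x"
    by (simp add: mat_vec_def sum_distrib_right)
  finally show ?thesis .
qed

lemma mat_vec_cong:
  assumes "\<And>y. y \<in> B \<Longrightarrow> c x y * f y = c' x y * f' y"
  shows "mat_vec B c f x = mat_vec B c' f' x"
  unfolding mat_vec_def using assms by (intro sum.cong) auto

lemma mat_vec_nonzero:
  assumes "mat_vec B c f x \<noteq> 0"
  obtains y where "y \<in> B" "c x y \<noteq> 0" "f y \<noteq> 0"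
proof -
  from assms obtain y where "y \<in> B" "c x y * f y \<noteq> 0"
    unfolding mat_vec_def by (metis (no_types, lifting) sum.neutral)
  then show ?thesis using that by (metis mult_zero_left mult_zero_right)
qed

lemma mat_vec_delta:
  assumes "finite B" "s \<in> B"
  shows "mat_vec B c (\<lambda>y. if y = s then a else 0) x = c x s * a"
  unfolding mat_vec_def using assms by (simp add: if_distrib sum.delta cong: if_cong)

lemma mat_vec_rows_zero:
  assumes "\<And>y. y \<in> B \<Longrightarrow> f y \<noteq> 0 \<Longrightarrow> c x y = 0"
  shows "mat_vec B c f x = 0"
  unfolding mat_vec_def using assms by (intro sum.neutral ballI) (metis mult_zero_left mult_zero_right)

text \<open>\<open>I U\<close> says that the monomials with support \<open>U\<close> lie in the
  resolved ideal. Read together, \<open>exact\<close> and \<open>augmentation\<close> say that the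
  strand at \<open>U\<close> has no homology in positive heights, and at height 0 the line spanned
  by \<open>e0\<close> or nothing, according to whether \<open>I U\<close> fails or holds. Vectors
  \<open>f\<close> are not split by height; \<open>f e0 = 0\<close> sets height 0 apart.\<close>

locale labelled_complex =
  fixes B :: "'b set" and h :: "'b \<Rightarrow> nat" and S :: "'b \<Rightarrow> 'v set"
    and c :: "'b \<Rightarrow> 'b \<Rightarrow> 'k::field" and e0 :: 'b and I :: "'v set \<Rightarrow> bool"
  assumes finite_B: "finite B"
    and e0_in: "e0 \<in> B" and h_e0: "h e0 = 0" and S_e0: "S e0 = {}"
    and height_zero: "x \<in> B \<Longrightarrow> h x = 0 \<Longrightarrow> x = e0"
    and c_nonzero: "c x y \<noteq> 0 \<Longrightarrow> x \<in> B \<and> y \<in> B \<and> h y = Suc (h x) \<and> S x \<subseteq> S y"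
    and square_zero: "mat_vec B c (\<lambda>y. c y z) x = 0"
    and exact: "(\<And>x. f x \<noteq> 0 \<Longrightarrow> x \<in> B \<and> S x \<subseteq> U) \<Longrightarrow> f e0 = 0 \<Longrightarrow> (\<And>x. mat_vec B c f x = 0)
      \<Longrightarrow> \<exists>g. (\<forall>x. g x \<noteq> 0 \<longrightarrow> x \<in> B \<and> S x \<subseteq> U) \<and> (\<forall>x. mat_vec B c g x = f x)"
    and augmentation: "I U \<longleftrightarrow> (\<exists>y. c e0 y \<noteq> 0 \<and> S y \<subseteq> U)"
begin

lemma mat_vec_square_zero: "mat_vec B c (mat_vec B c f) x = 0"
  unfolding mat_vec_mat_vec by (rule mat_vec_rows_zero) (simp add: square_zero)

text \<open>\<open>exact\<close> leaves out height 0; there \<open>augmentation\<close> supplies a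
  basis element whose column hits \<open>e0\<close>. Cutting a preimage down to height
  \<open>Suc i\<close> is harmless because the matrix lowers the height by exactly one.\<close>

lemma cycle_lift:
  assumes f: "\<And>x. f x \<noteq> 0 \<Longrightarrow> x \<in> B \<and> S x \<subseteq> U \<and> h x = i"
    and f0: "f e0 \<noteq> 0 \<Longrightarrow> I U" and cyc: "\<And>x. mat_vec B c f x = 0"
  shows "\<exists>g. (\<forall>x. g x \<noteq> 0 \<longrightarrow> x \<in> B \<and> S x \<subseteq> U \<and> h x = Suc i) \<and> (\<forall>x. mat_vec B c g x = f x)"
proof -
  have ex: "\<exists>g. (\<forall>x. g x \<noteq> 0 \<longrightarrow> x \<in> B \<and> S x \<subseteq> U) \<and> (\<forall>x. h x = i \<longrightarrow> mat_vec B c g x = f x)"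
  proof (cases "f e0 = 0")
    case True
    then show ?thesis using exact[of f U] f cyc by metis
  next
    case False
    then obtain y where y: "c e0 y \<noteq> 0" "S y \<subseteq> U" using f0 augmentation by blast
    then have yB: "y \<in> B" using c_nonzero by blast
    have i: "i = 0" using f[OF False] h_e0 by simp
    \<comment> \<open>\<open>y\<close> has height 1, so its column is concentrated on
      \<open>e0\<close>, the only element of height 0.\<close>
    let ?g = "\<lambda>z. if z = y then f e0 / c e0 y else 0"
    have "mat_vec B c ?g x = f x" if "h x = i" for x
    proof (cases "x \<in> B")
      case True
      then have "x = e0" using height_zero that i by simp
      then show ?thesis using mat_vec_delta[OF finite_B yB, of c "f e0 / c e0 y"] y by simp
    next
      case False
      then have "f x = 0" "c x y = 0" using f c_nonzero by blast+
      then show ?thesis using mat_vec_delta[OF finite_B yB, of c "f e0 / c e0 y"] by simp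
    qed
    then show ?thesis using y yB by (intro exI[of _ ?g]) auto
  qed
  then obtain g where g: "\<And>x. g x \<noteq> 0 \<Longrightarrow> x \<in> B \<and> S x \<subseteq> U" "\<And>x. h x = i \<Longrightarrow> mat_vec B c g x = f x"
    by blast
  let ?g = "\<lambda>x. if h x = Suc i then g x else 0"
  have "mat_vec B c ?g x = f x" for x
  proof (cases "h x = i")
    case True
    have "mat_vec B c ?g x = mat_vec B c g x"
      by (rule mat_vec_cong) (use True c_nonzero in force)
    then show ?thesis using g True by simp
  next
    case False
    have "mat_vec B c ?g x = 0"
      by (rule mat_vec_rows_zero) (use False c_nonzero in \<open>force split: if_splits\<close>)
    then show ?thesis using f False by metis
  qed
  then show ?thesis using g(1) by (intro exI[of _ ?g]) auto
qed

lemma reindex: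
  assumes "inj_on \<alpha> B"
  defines "\<beta> \<equiv> inv_into B \<alpha>"
  shows "labelled_complex (\<alpha> ` B) (h \<circ> \<beta>) (S \<circ> \<beta>)
    (\<lambda>x y. if x \<in> \<alpha> ` B \<and> y \<in> \<alpha> ` B then c (\<beta> x) (\<beta> y) else 0) (\<alpha> e0) I"
    (is "labelled_complex ?B ?h ?S ?c ?e I")
proof -
  have \<beta>\<alpha>: "\<beta> (\<alpha> x) = x" if "x \<in> B" for x using that assms by simp
  have \<alpha>\<beta>: "\<alpha> (\<beta> x) = x" "\<beta> x \<in> B" if "x \<in> \<alpha> ` B" for x
    using that assms by (auto simp: f_inv_into_f inv_into_into)
  have ap1: "mat_vec ?B ?c f x = (if x \<in> ?B then mat_vec B c (f \<circ> \<alpha>) (\<beta> x) else 0)" for f x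
    unfolding mat_vec_def by (simp add: sum.reindex[OF assms(1)] \<beta>\<alpha> cong: sum.cong)
  show ?thesis
  proof
    show "finite ?B" "?e \<in> ?B" "?h ?e = 0" "?S ?e = {}"
      using finite_B e0_in h_e0 S_e0 \<beta>\<alpha> by auto
    show "x = ?e" if "x \<in> ?B" "?h x = 0" for x
      using that \<alpha>\<beta> height_zero by (metis comp_apply)
    show "x \<in> ?B \<and> y \<in> ?B \<and> ?h y = Suc (?h x) \<and> ?S x \<subseteq> ?S y" if "?c x y \<noteq> 0" for x y
      using that c_nonzero[of "\<beta> x" "\<beta> y"] by (auto split: if_splits)
    show "mat_vec ?B ?c (\<lambda>y. ?c y z) x = 0" for x z
    proof -
      have "mat_vec B c (\<lambda>y. ?c (\<alpha> y) z) (\<beta> x) = (if z \<in> ?B then mat_vec B c (\<lambda>y. c y (\<beta> z)) (\<beta> x) else 0)"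
        by (auto intro!: mat_vec_cong simp: \<beta>\<alpha>)
      then show ?thesis unfolding ap1 comp_def by (simp add: square_zero)
    qed
    show "\<exists>g. (\<forall>x. g x \<noteq> 0 \<longrightarrow> x \<in> ?B \<and> ?S x \<subseteq> U) \<and> (\<forall>x. mat_vec ?B ?c g x = f x)"
      if f: "\<And>x. f x \<noteq> 0 \<Longrightarrow> x \<in> ?B \<and> ?S x \<subseteq> U" and f0: "f ?e = 0" and cyc: "\<And>x. mat_vec ?B ?c f x = 0"
      for f U
    proof -
      let ?f = "\<lambda>x. if x \<in> B then f (\<alpha> x) else 0"
      have apf: "mat_vec B c ?f x = mat_vec B c (f \<circ> \<alpha>) x" for x by (rule mat_vec_cong) simp
      have "\<exists>g. (\<forall>x. g x \<noteq> 0 \<longrightarrow> x \<in> B \<and> S x \<subseteq> U) \<and> (\<forall>x. mat_vec B c g x = ?f x)"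
      proof (rule exact)
        show "x \<in> B \<and> S x \<subseteq> U" if "?f x \<noteq> 0" for x
          using that f[of "\<alpha> x"] \<beta>\<alpha>[of x] by (auto split: if_splits)
        show "?f e0 = 0" using f0 by simp
        show "mat_vec B c ?f x = 0" for x
        proof (cases "x \<in> B")
          case True
          then show ?thesis using cyc[of "\<alpha> x"] unfolding ap1 apf by (simp add: \<beta>\<alpha>)
        next
          case False
          then show ?thesis by (intro mat_vec_rows_zero) (use c_nonzero in blast)
        qed
      qed
      then obtain g where g: "\<And>x. g x \<noteq> 0 \<Longrightarrow> x \<in> B \<and> S x \<subseteq> U" "\<And>x. mat_vec B c g x = ?f x"
        by blast
      let ?g = "\<lambda>x. if x \<in> ?B then g (\<beta> x) else 0"
      have "mat_vec ?B ?c ?g x = f x" for x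
      proof (cases "x \<in> ?B")
        case True
        have "mat_vec B c (?g \<circ> \<alpha>) (\<beta> x) = mat_vec B c g (\<beta> x)"
          by (rule mat_vec_cong) (simp add: \<beta>\<alpha>)
        then show ?thesis using True g(2)[of "\<beta> x"] \<alpha>\<beta> unfolding ap1 by simp
      next
        case False
        then show ?thesis using f[of x] unfolding ap1 by auto
      qed
      then show ?thesis using g(1) by (intro exI[of _ ?g]) (auto split: if_splits)
    qed
    show "I U = (\<exists>y. ?c ?e y \<noteq> 0 \<and> ?S y \<subseteq> U)" for U
    proof
      assume "I U"
      then obtain y where y: "c e0 y \<noteq> 0" "S y \<subseteq> U" using augmentation by blast
      then have "y \<in> B" using c_nonzero by blast
      then show "\<exists>y. ?c ?e y \<noteq> 0 \<and> ?S y \<subseteq> U"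
        using y e0_in \<beta>\<alpha> by (intro exI[of _ "\<alpha> y"]) auto
    next
      assume "\<exists>y. ?c ?e y \<noteq> 0 \<and> ?S y \<subseteq> U"
      then obtain y where "c e0 (\<beta> y) \<noteq> 0" "S (\<beta> y) \<subseteq> U"
        using e0_in \<beta>\<alpha> by (auto split: if_splits)
      then show "I U" using augmentation by blast
    qed
  qed
qed

text \<open>The strand at \<open>U\<close> of the new complex is the strand at
  \<open>U \<inter> W\<close> of the old one, so exactness is inherited. This will be applied with
  \<open>W\<close> the vertex set of an induced matching.\<close>

lemma restrict:
  "labelled_complex {x \<in> B. S x \<subseteq> W} h S (\<lambda>x y. if S y \<subseteq> W then c x y else 0) e0 (\<lambda>U. I (U \<inter> W))"
    (is "labelled_complex ?B h S ?c e0 ?I")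
proof -
  have ap1: "mat_vec ?B ?c f x = mat_vec B c f x" if "\<And>x. f x \<noteq> 0 \<Longrightarrow> S x \<subseteq> W" for f x
  proof -
    have "mat_vec B c f x = mat_vec ?B c f x"
      unfolding mat_vec_def by (rule sum.mono_neutral_right) (use finite_B that in auto)
    also have "\<dots> = mat_vec ?B ?c f x" by (rule mat_vec_cong) auto
    finally show ?thesis by simp
  qed
  show ?thesis
  proof
    show "finite ?B" "e0 \<in> ?B" "h e0 = 0" "S e0 = {}" using finite_B e0_in h_e0 S_e0 by auto
    show "x = e0" if "x \<in> ?B" "h x = 0" for x using that height_zero by simp
    show "x \<in> ?B \<and> y \<in> ?B \<and> h y = Suc (h x) \<and> S x \<subseteq> S y" if "?c x y \<noteq> 0" for x y
      using that c_nonzero[of x y] by (auto split: if_splits)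
    show "mat_vec ?B ?c (\<lambda>y. ?c y z) x = 0" for x z
    proof (cases "S z \<subseteq> W")
      case True
      have "mat_vec ?B ?c (\<lambda>y. c y z) x = mat_vec B c (\<lambda>y. c y z) x"
        by (rule ap1) (use True c_nonzero in blast)
      then show ?thesis using True square_zero by simp
    qed simp
    show "\<exists>g. (\<forall>x. g x \<noteq> 0 \<longrightarrow> x \<in> ?B \<and> S x \<subseteq> U) \<and> (\<forall>x. mat_vec ?B ?c g x = f x)"
      if f: "\<And>x. f x \<noteq> 0 \<Longrightarrow> x \<in> ?B \<and> S x \<subseteq> U" and f0: "f e0 = 0" and cyc: "\<And>x. mat_vec ?B ?c f x = 0"
      for f U
    proof -
      have "\<exists>g. (\<forall>x. g x \<noteq> 0 \<longrightarrow> x \<in> B \<and> S x \<subseteq> U \<inter> W) \<and> (\<forall>x. mat_vec B c g x = f x)"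
        using exact[of f "U \<inter> W"] f f0 cyc ap1[of f] by (simp add: subset_iff)
      then obtain g where g: "\<And>x. g x \<noteq> 0 \<Longrightarrow> x \<in> B \<and> S x \<subseteq> U \<inter> W" "\<And>x. mat_vec B c g x = f x"
        by blast
      then show ?thesis using ap1[of g] by (intro exI[of _ g]) auto
    qed
    show "?I U = (\<exists>y. ?c e0 y \<noteq> 0 \<and> S y \<subseteq> U)" for U
      unfolding augmentation by auto
  qed
qed

text \<open>Gaussian elimination of a scalar entry between two basis elements with the same label.\<close>

lemma cancel:
  assumes rs: "c r s \<noteq> 0" "S r = S s" and proper: "\<not> I {}"
  defines "B' \<equiv> B - {r, s}"
  shows "labelled_complex B' h S
    (\<lambda>x y. if x \<in> B' \<and> y \<in> B' then c x y - c x s * c r y / c r s else 0) e0 I"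
    (is "labelled_complex B' h S ?c e0 I")
proof -
  have rsB: "r \<in> B" "s \<in> B" "h s = Suc (h r)" using c_nonzero[OF rs(1)] by auto
  \<comment> \<open>If \<open>r\<close> were \<open>e0\<close>, then \<open>s\<close> would have the
    empty label and the ideal would contain 1.\<close>
  have hr: "h r \<noteq> 0"
  proof
    assume "h r = 0"
    then have "r = e0" using height_zero rsB by simp
    then show False using proper augmentation rs S_e0 by (metis order_refl)
  qed
  have ne: "r \<noteq> s" "r \<noteq> e0" "s \<noteq> e0" using rsB hr h_e0 by auto
  have B: "B = insert r (insert s B')" "r \<notin> insert s B'" "s \<notin> B'" "finite B'"
    using rsB ne finite_B by (auto simp: B'_def)
  have split: "mat_vec B d f x = d x r * f r + d x s * f s + mat_vec B' d f x" for d :: "'b \<Rightarrow> 'b \<Rightarrow> 'k" and f x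
    unfolding mat_vec_def using B by (simp add: add.assoc)
  \<comment> \<open>\<open>hat f\<close> extends \<open>f\<close> from \<open>B'\<close> to
    \<open>B\<close> by 0 at \<open>r\<close> and by the one value at \<open>s\<close> that makes
    the \<open>r\<close>-coordinate of the boundary vanish. Such vectors form a subcomplex of the
    old complex, \<open>hat\<close> identifies the reduced complex with it, and exactness is
    transported along this identification.\<close>
  define hat where "hat f y = (if y = s then - (mat_vec B' c f r / c r s) else if y \<in> B' then f y else 0)" for f y
  have hat_B': "mat_vec B' d (hat f) x = mat_vec B' d f x" for d f x
    by (rule mat_vec_cong) (use B in \<open>auto simp: hat_def\<close>)
  have hat_rs: "hat f r = 0" "hat f s = - (mat_vec B' c f r / c r s)" for f
    using B ne by (auto simp: hat_def)
  have mat_vec': "mat_vec B' ?c f x = (if x \<in> B' then mat_vec B c (hat f) x else 0)" for f x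
  proof (cases "x \<in> B'")
    case True
    have "mat_vec B' ?c f x = (\<Sum>y\<in>B'. c x y * f y - c x s / c r s * (c r y * f y))"
      unfolding mat_vec_def using True by (intro sum.cong) (auto simp: field_simps)
    also have "\<dots> = mat_vec B' c f x - c x s / c r s * mat_vec B' c f r"
      by (simp add: mat_vec_def sum_subtractf sum_distrib_left)
    also have "\<dots> = mat_vec B c (hat f) x"
      unfolding split hat_B' hat_rs by simp
    finally show ?thesis using True by simp
  qed (simp add: mat_vec_def)
  have hat_r: "mat_vec B c (hat f) r = 0" for f
    unfolding split hat_B' hat_rs using rs by simp
  have hat_id: "hat w = w" if "w r = 0" "mat_vec B c w r = 0" "\<And>x. w x \<noteq> 0 \<Longrightarrow> x \<in> B" for w
  proof
    fix y
    have "c r s * w s + mat_vec B' c w r = 0" using that split[of c w r] by simp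
    then have "w s = - (mat_vec B' c w r / c r s)"
      using rs by (simp add: field_simps add_eq_0_iff2)
    then show "hat w y = w y" using that B unfolding hat_def by (metis insertE)
  qed
  have hat_dep: "hat f = hat g" if "\<And>y. y \<in> B' \<Longrightarrow> f y = g y" for f g
  proof -
    have "mat_vec B' c f r = mat_vec B' c g r" by (rule mat_vec_cong) (use that in auto)
    then show ?thesis using that by (auto simp: hat_def)
  qed
  have D_supp: "x \<in> B" if "mat_vec B c f x \<noteq> 0" for f x
    using that c_nonzero by (metis mat_vec_nonzero)
  have hat_D: "hat (mat_vec B' ?c f) = mat_vec B c (hat f)" for f
  proof -
    have "hat (mat_vec B' ?c f) = hat (mat_vec B c (hat f))" by (rule hat_dep) (simp add: mat_vec')
    also have "\<dots> = mat_vec B c (hat f)"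
      by (rule hat_id) (use hat_r mat_vec_square_zero D_supp in auto)
    finally show ?thesis .
  qed
  have sq: "mat_vec B' ?c (mat_vec B' ?c f) x = 0" for f x
    unfolding mat_vec'[of "mat_vec B' ?c f"] hat_D mat_vec_square_zero by simp
  show ?thesis
  proof
    show "finite B'" "e0 \<in> B'" "h e0 = 0" "S e0 = {}" using B e0_in h_e0 S_e0 ne by auto
    show "x = e0" if "x \<in> B'" "h x = 0" for x using that height_zero B by simp
    show "x \<in> B' \<and> y \<in> B' \<and> h y = Suc (h x) \<and> S x \<subseteq> S y" if nz: "?c x y \<noteq> 0" for x y
    proof -
      have xy: "x \<in> B'" "y \<in> B'" using nz by (auto split: if_splits)
      have "c x y \<noteq> 0 \<or> (c x s \<noteq> 0 \<and> c r y \<noteq> 0)" using nz by (auto split: if_splits)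
      then consider "c x y \<noteq> 0" | "c x s \<noteq> 0" "c r y \<noteq> 0" by blast
      then show ?thesis
      proof cases
        case 1
        then show ?thesis using c_nonzero xy by blast
      next
        case 2
        then show ?thesis using c_nonzero[OF 2(1)] c_nonzero[OF 2(2)] xy rs rsB by auto
      qed
    qed
    show "mat_vec B' ?c (\<lambda>y. ?c y z) x = 0" for x z
    proof (cases "z \<in> B'")
      case True
      have "mat_vec B' ?c (\<lambda>y. if y = z then 1 else 0) = (\<lambda>y. ?c y z)"
        using mat_vec_delta[OF B(4) True, of ?c 1] by (intro ext) simp
      from sq[of "\<lambda>y. if y = z then 1 else 0" x, unfolded this] show ?thesis .
    qed (simp add: mat_vec_def)
    show "\<exists>g. (\<forall>x. g x \<noteq> 0 \<longrightarrow> x \<in> B' \<and> S x \<subseteq> U) \<and> (\<forall>x. mat_vec B' ?c g x = f x)"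
      if f: "\<And>x. f x \<noteq> 0 \<Longrightarrow> x \<in> B' \<and> S x \<subseteq> U" and f0: "f e0 = 0" and cyc: "\<And>x. mat_vec B' ?c f x = 0"
      for f U
    proof -
      have Dw: "mat_vec B c (hat f) x = 0" for x
      proof -
        have *: "mat_vec B c (hat f) x = 0" if "x \<noteq> s" for x
        proof (cases "x \<in> B'")
          case True
          then show ?thesis using cyc[of x] mat_vec'[of f x] by simp
        next
          case False
          then have "x = r \<or> x \<notin> B" using B(1) that by blast
          then show ?thesis using hat_r D_supp by blast
        qed
        have "c r s * mat_vec B c (hat f) s + mat_vec B' c (mat_vec B c (hat f)) r = 0"
          using mat_vec_square_zero[of "hat f" r] hat_r[of f] by (simp add: split[of c "mat_vec B c (hat f)"])
        moreover have "mat_vec B' c (mat_vec B c (hat f)) r = 0"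
          by (rule mat_vec_rows_zero) (use * B(3) in metis)
        ultimately have "mat_vec B c (hat f) s = 0" using rs by simp
        then show ?thesis using * by metis
      qed
      have "\<exists>g. (\<forall>x. g x \<noteq> 0 \<longrightarrow> x \<in> B \<and> S x \<subseteq> U) \<and> (\<forall>x. mat_vec B c g x = hat f x)"
      proof (rule exact)
        show "x \<in> B \<and> S x \<subseteq> U" if nz: "hat f x \<noteq> 0" for x
        proof (cases "x = s")
          case True
          then have "mat_vec B' c f r \<noteq> 0" using nz by (simp add: hat_rs)
          then obtain y where y: "c r y \<noteq> 0" "f y \<noteq> 0" by (rule mat_vec_nonzero)
          then have "S r \<subseteq> U" using c_nonzero[OF y(1)] f[OF y(2)] by auto
          then show ?thesis using True rs rsB by simp
        next
          case False
          then show ?thesis using nz f B unfolding hat_def by (auto split: if_splits)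
        qed
        show "hat f e0 = 0" using ne f0 by (simp add: hat_def)
      qed (use Dw in simp)
      then obtain g where g: "\<And>x. g x \<noteq> 0 \<Longrightarrow> x \<in> B \<and> S x \<subseteq> U" "\<And>x. mat_vec B c g x = hat f x"
        by blast
      \<comment> \<open>Column \<open>s\<close> is a cycle, so subtracting a multiple of it clears
        the \<open>r\<close>-coordinate without changing the boundary.\<close>
      define g1 where "g1 x = g x - c x s * (g r / c r s)" for x
      have Dg1: "mat_vec B c g1 x = hat f x" for x
        unfolding g1_def mat_vec_diff mat_vec_scale g(2) square_zero by simp
      have g1_supp: "x \<in> B \<and> S x \<subseteq> U" if "g1 x \<noteq> 0" for x
      proof (cases "g x = 0")
        case True
        then have "c x s \<noteq> 0" "g r \<noteq> 0" using that by (auto simp: g1_def)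
        then show ?thesis using c_nonzero[of x s] g(1)[of r] rs by auto
      qed (use g in blast)
      have g1: "hat g1 = g1"
        by (rule hat_id) (use g1_supp rs Dg1 hat_rs in \<open>auto simp: g1_def\<close>)
      let ?g = "\<lambda>x. if x \<in> B' then g1 x else 0"
      have "hat ?g = g1" using hat_dep[of ?g g1] g1 by simp
      then have "mat_vec B' ?c ?g x = f x" for x
        unfolding mat_vec' using f[of x] Dg1[of x] B by (auto simp: hat_def)
      then show ?thesis using g1_supp by (intro exI[of _ ?g]) auto
    qed
    show "I U = (\<exists>y. ?c e0 y \<noteq> 0 \<and> S y \<subseteq> U)" for U
    proof -
      have e0B: "e0 \<in> B'" using e0_in ne by (simp add: B'_def)
      have cs: "c e0 s = 0" using c_nonzero[of e0 s] rsB hr h_e0 by auto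
      have c': "?c e0 y = (if y \<in> B' then c e0 y else 0)" for y using e0B cs by simp
      show ?thesis
      proof
        assume "I U"
        then obtain y where y: "c e0 y \<noteq> 0" "S y \<subseteq> U" using augmentation by blast
        show "\<exists>y. ?c e0 y \<noteq> 0 \<and> S y \<subseteq> U"
        proof (cases "y = r")
          case False
          then show ?thesis using y cs c_nonzero[OF y(1)] B(1) unfolding c' by (intro exI[of _ y]) auto
        next
          case True
          \<comment> \<open>The witness \<open>r\<close> is no longer available. Vanishing of the
            square at \<open>(e0, s)\<close> forces a second path from \<open>s\<close> to
            \<open>e0\<close> through some \<open>z\<close>, and
            \<open>S z \<subseteq> S s = S r\<close>.\<close>
          have "mat_vec B' c (\<lambda>y. c y s) e0 \<noteq> 0"
            using square_zero[of s e0] True y rs cs unfolding split by auto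
          then obtain z where z: "z \<in> B'" "c e0 z \<noteq> 0" "c z s \<noteq> 0" by (rule mat_vec_nonzero)
          then have "S z \<subseteq> U" using c_nonzero[OF z(3)] rs y True by auto
          then show ?thesis using z unfolding c' by auto
        qed
      next
        assume "\<exists>y. ?c e0 y \<noteq> 0 \<and> S y \<subseteq> U"
        then show "I U" unfolding c' augmentation by (auto split: if_splits)
      qed
    qed
  qed
qed

end

text \<open>The scalar \<open>c x y\<close> stands for a multiple of the monomial with support
  \<open>S y - S x\<close>, and \<open>S x \<subseteq> S y\<close> holds in a complex, so equal
  labels are the case of a unit entry.\<close>

definition minimal_labels :: "('b \<Rightarrow> 'v set) \<Rightarrow> ('b \<Rightarrow> 'b \<Rightarrow> 'k::zero) \<Rightarrow> bool" where
  "minimal_labels S c \<longleftrightarrow> (\<forall>x y. c x y \<noteq> 0 \<longrightarrow> S x \<noteq> S y)"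

text \<open>Cancellation keeps the heights and labels of the surviving elements and changes only the
  matrix, so every degree bound on \<open>B\<close> passes to \<open>B'\<close>.\<close>

lemma minimal_subcomplex:
  fixes c :: "'b \<Rightarrow> 'b \<Rightarrow> 'k::field"
  assumes "labelled_complex B h S c e0 I" "\<not> I {}"
  shows "\<exists>B' (c' :: 'b \<Rightarrow> 'b \<Rightarrow> 'k). B' \<subseteq> B \<and> labelled_complex B' h S c' e0 I \<and> minimal_labels S c'"
  using assms(1)
proof (induction "card B" arbitrary: B c rule: less_induct)
  case less
  interpret labelled_complex B h S c e0 I by (rule less.prems)
  show ?case
  proof (cases "minimal_labels S c")
    case False
    then obtain r s where rs: "c r s \<noteq> 0" "S r = S s" by (auto simp: minimal_labels_def)
    have "r \<in> B" using c_nonzero[OF rs(1)] by simp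
    then have lt: "card (B - {r, s}) < card B" using finite_B by (intro psubset_card_mono) auto
    obtain B' and c' :: "'b \<Rightarrow> 'b \<Rightarrow> 'k" where "B' \<subseteq> B - {r, s}" "labelled_complex B' h S c' e0 I" "minimal_labels S c'"
      using less.hyps[OF lt cancel[OF rs assms(2)]] by (elim exE conjE)
    then show ?thesis by (intro exI[of _ B'] exI[of _ c']) auto
  next
    case True
    then show ?thesis using less.prems by (intro exI[of _ B] exI[of _ c]) simp
  qed
qed

text \<open>A lift of the multiplication by a monomial with support \<open>m\<close> to the resolutions of
  \<open>R/(J : m)\<close> and \<open>R/J\<close>.\<close>

lemma comparison:
  assumes P: "labelled_complex B h S (c :: 'b \<Rightarrow> 'b \<Rightarrow> 'k::field) e0 I"
    and Q: "labelled_complex B' h' S' (c' :: 'd \<Rightarrow> 'd \<Rightarrow> 'k) e0' I'"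
    and II: "\<And>U. I' U \<Longrightarrow> I (U \<union> m)"
  shows "\<exists>\<phi>. (\<forall>x y. \<phi> x y \<noteq> 0 \<longrightarrow> x \<in> B \<and> y \<in> B' \<and> h x = h' y \<and> S x \<subseteq> S' y \<union> m) \<and> \<phi> e0 e0' = 1 \<and>
    (\<forall>x y. mat_vec B c (\<lambda>x. \<phi> x y) x = mat_vec B' \<phi> (\<lambda>z. c' z y) x)"
proof -
  interpret P: labelled_complex B h S c e0 I by (rule P)
  interpret Q: labelled_complex B' h' S' c' e0' I' by (rule Q)
  \<comment> \<open>A lift on the columns of height below \<open>n\<close>, extended one height at a
    time. The new column at \<open>y\<close> must be a preimage of the image under
    \<open>\<phi>\<close> of the boundary of \<open>y\<close>; it is found among labels inside
    \<open>S' y \<union> m\<close>.\<close>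
  define good where "good n \<phi> \<longleftrightarrow>
    (\<forall>x y. \<phi> x y \<noteq> 0 \<longrightarrow> x \<in> B \<and> y \<in> B' \<and> h x = h' y \<and> S x \<subseteq> S' y \<union> m \<and> h' y < n) \<and>
    (0 < n \<longrightarrow> \<phi> e0 e0' = 1) \<and>
    (\<forall>x y. h' y < n \<longrightarrow> mat_vec B c (\<lambda>x. \<phi> x y) x = mat_vec B' \<phi> (\<lambda>z. c' z y) x)" for n \<phi>
  have "\<exists>\<phi>. good n \<phi>" for n
  proof (induction n)
    case 0
    show ?case by (rule exI[of _ "\<lambda>x y. 0"]) (simp add: good_def)
  next
    case (Suc n)
    then obtain \<phi> where \<phi>: "good n \<phi>" by blast
    have col: "\<exists>g. (\<forall>x. g x \<noteq> 0 \<longrightarrow> x \<in> B \<and> h x = n \<and> S x \<subseteq> S' y \<union> m) \<and>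
      (y = e0' \<longrightarrow> g e0 = 1) \<and> (\<forall>x. mat_vec B c g x = mat_vec B' \<phi> (\<lambda>z. c' z y) x)"
      if y: "y \<in> B'" "h' y = n" for y
    proof (cases n)
      case 0
      then have y0: "y = e0'" using y Q.height_zero by simp
      have no: "c x e0 = 0" "c' z e0' = 0" for x z
        using P.c_nonzero[of x e0] Q.c_nonzero[of z e0'] P.h_e0 Q.h_e0 by auto
      have "mat_vec B c (\<lambda>x. if x = e0 then 1 else 0) x = mat_vec B' \<phi> (\<lambda>z. c' z y) x" for x
        unfolding mat_vec_delta[OF P.finite_B P.e0_in] y0 no by simp
      then show ?thesis using P.e0_in P.h_e0 P.S_e0 0
        by (intro exI[of _ "\<lambda>x. if x = e0 then 1 else 0"]) auto
    next
      case (Suc i)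
      have y0: "y \<noteq> e0'" using Suc y Q.h_e0 by auto
      have zi: "h' z = i" "S' z \<subseteq> S' y" if "c' z y \<noteq> 0" for z
        using Q.c_nonzero[OF that] y Suc by auto
      let ?f = "mat_vec B' \<phi> (\<lambda>z. c' z y)"
      have ex: "\<exists>g. (\<forall>x. g x \<noteq> 0 \<longrightarrow> x \<in> B \<and> S x \<subseteq> S' y \<union> m \<and> h x = Suc i) \<and> (\<forall>x. mat_vec B c g x = ?f x)"
      proof (rule P.cycle_lift)
        show "x \<in> B \<and> S x \<subseteq> S' y \<union> m \<and> h x = i" if nz: "?f x \<noteq> 0" for x
        proof -
          obtain z where z: "\<phi> x z \<noteq> 0" "c' z y \<noteq> 0" using mat_vec_nonzero[OF nz] by metis
          then show ?thesis using zi[OF z(2)] \<phi> unfolding good_def by blast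
        qed
        \<comment> \<open>The cycle can have an \<open>e0\<close>-coordinate only if
          \<open>c' e0' y\<close> is nonzero. Then \<open>I' (S' y)\<close> holds, and the
          hypothesis \<open>II\<close> gives what \<open>cycle_lift\<close> asks for.\<close>
        show "I (S' y \<union> m)" if nz: "?f e0 \<noteq> 0"
        proof -
          obtain z where z: "\<phi> e0 z \<noteq> 0" "c' z y \<noteq> 0" using mat_vec_nonzero[OF nz] by metis
          then have "z = e0'" using \<phi> Q.height_zero P.h_e0 unfolding good_def by metis
          then have "I' (S' y)" using z Q.augmentation by blast
          then show ?thesis by (rule II)
        qed
        show "mat_vec B c ?f x = 0" for x
        proof -
          have "mat_vec B c ?f x = mat_vec B' (\<lambda>x z. mat_vec B c (\<lambda>y. \<phi> y z) x) (\<lambda>z. c' z y) x" by (rule mat_vec_mat_vec)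
          also have "\<dots> = mat_vec B' (\<lambda>x z. mat_vec B' \<phi> (\<lambda>w. c' w z) x) (\<lambda>z. c' z y) x"
          proof (rule mat_vec_cong)
            fix z
            show "mat_vec B c (\<lambda>y. \<phi> y z) x * c' z y = mat_vec B' \<phi> (\<lambda>w. c' w z) x * c' z y"
              using zi[of z] \<phi> Suc unfolding good_def by (cases "c' z y = 0") auto
          qed
          also have "\<dots> = mat_vec B' \<phi> (mat_vec B' c' (\<lambda>z. c' z y)) x" by (rule mat_vec_mat_vec[symmetric])
          also have "\<dots> = 0" by (rule mat_vec_rows_zero) (simp add: Q.square_zero)
          finally show ?thesis .
        qed
      qed
      then show ?thesis using y0 Suc by metis
    qed
    obtain g where g: "\<And>y. y \<in> B' \<Longrightarrow> h' y = n \<Longrightarrow> (\<forall>x. g y x \<noteq> 0 \<longrightarrow> x \<in> B \<and> h x = n \<and> S x \<subseteq> S' y \<union> m) \<and>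
      (y = e0' \<longrightarrow> g y e0 = 1) \<and> (\<forall>x. mat_vec B c (g y) x = mat_vec B' \<phi> (\<lambda>z. c' z y) x)"
      using col by metis
    define \<psi> where "\<psi> x y = (if y \<in> B' \<and> h' y = n then g y x else \<phi> x y)" for x y
    have rhs: "mat_vec B' \<psi> (\<lambda>z. c' z y) x = mat_vec B' \<phi> (\<lambda>z. c' z y) x" if "h' y < Suc n" for x y
      by (rule mat_vec_cong) (use that Q.c_nonzero[of _ y] in \<open>force simp: \<psi>_def\<close>)
    have "good (Suc n) \<psi>"
      unfolding good_def
    proof (intro conjI allI impI)
      fix x y assume nz: "\<psi> x y \<noteq> 0"
      show "x \<in> B" "y \<in> B'" "h x = h' y" "S x \<subseteq> S' y \<union> m" "h' y < Suc n"
        using nz g[of y] \<phi> unfolding \<psi>_def good_def by (auto split: if_splits intro: less_SucI)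
    next
      show "\<psi> e0 e0' = 1" using g[of e0'] Q.e0_in Q.h_e0 \<phi> unfolding \<psi>_def good_def
        by (auto split: if_splits)
    next
      fix x y assume lt: "h' y < Suc n"
      show "mat_vec B c (\<lambda>x. \<psi> x y) x = mat_vec B' \<psi> (\<lambda>z. c' z y) x"
      proof (cases "y \<in> B' \<and> h' y = n")
        case True
        then show ?thesis unfolding rhs[OF lt] using g[of y] by (simp add: \<psi>_def)
      next
        case no: False
        show ?thesis
        proof (cases "y \<in> B'")
          case True
          then have "h' y < n" using no lt by auto
          then show ?thesis unfolding rhs[OF lt] using no \<phi> by (simp add: \<psi>_def good_def)
        next
          case False
          have "mat_vec B c (\<lambda>x. \<psi> x y) x = 0"
            by (rule mat_vec_rows_zero) (use False \<phi> in \<open>auto simp: \<psi>_def good_def\<close>)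
          moreover have "mat_vec B' \<psi> (\<lambda>z. c' z y) x = 0"
            by (rule mat_vec_rows_zero) (use False Q.c_nonzero in blast)
          ultimately show ?thesis by simp
        qed
      qed
    qed
    then show ?case by blast
  qed
  then obtain \<phi> where \<phi>: "good (Suc (Max (h' ` B'))) \<phi>" by blast
  have lt: "h' y < Suc (Max (h' ` B'))" if "y \<in> B'" for y
    using that Q.finite_B by (simp add: less_Suc_eq_le)
  have "mat_vec B c (\<lambda>x. \<phi> x y) x = mat_vec B' \<phi> (\<lambda>z. c' z y) x" for x y
  proof (cases "y \<in> B'")
    case False
    have "mat_vec B c (\<lambda>x. \<phi> x y) x = 0"
      by (rule mat_vec_rows_zero) (use False \<phi> in \<open>auto simp: good_def\<close>)
    moreover have "mat_vec B' \<phi> (\<lambda>z. c' z y) x = 0"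
      by (rule mat_vec_rows_zero) (use False Q.c_nonzero in blast)
    ultimately show ?thesis by simp
  qed (use \<phi> lt in \<open>auto simp: good_def\<close>)
  then show ?thesis using \<phi> unfolding good_def by (intro exI[of _ \<phi>]) auto
qed

text \<open>The sign in the last block turns commutation of \<open>\<phi>\<close> with the
  differentials into vanishing of the square.\<close>

fun cone :: "('b \<Rightarrow> 'b \<Rightarrow> 'k::field) \<Rightarrow> ('d \<Rightarrow> 'd \<Rightarrow> 'k) \<Rightarrow> ('b \<Rightarrow> 'd \<Rightarrow> 'k) \<Rightarrow> 'b + 'd \<Rightarrow> 'b + 'd \<Rightarrow> 'k" where
  "cone c c' \<phi> (Inl x) (Inl y) = c x y"
| "cone c c' \<phi> (Inl x) (Inr y) = \<phi> x y"
| "cone c c' \<phi> (Inr x) (Inl y) = 0"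
| "cone c c' \<phi> (Inr x) (Inr y) = - c' x y"

lemma mat_vec_cone:
  assumes "finite B" "finite B'"
  shows "mat_vec (B <+> B') (cone c c' \<phi>) f (Inl x) = mat_vec B c (\<lambda>x. f (Inl x)) x + mat_vec B' \<phi> (\<lambda>x. f (Inr x)) x"
    and "mat_vec (B <+> B') (cone c c' \<phi>) f (Inr y) = - mat_vec B' c' (\<lambda>x. f (Inr x)) y"
  using assms by (simp_all add: mat_vec_def sum.Plus sum_negf)

text \<open>The second summand enters the strand at \<open>U\<close> only if
  \<open>m \<subseteq> U\<close>. In that case \<open>I' U\<close> and \<open>I U\<close> agree and
  \<open>\<phi>\<close> sends \<open>e0'\<close> to \<open>e0\<close>, hence is an isomorphism on
  homology, and the strand of the cone is acyclic. Otherwise it is the strand of the first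
  complex.\<close>

lemma mapping_cone:
  assumes P: "labelled_complex B h S (c :: 'b \<Rightarrow> 'b \<Rightarrow> 'k::field) e0 I"
    and Q: "labelled_complex B' h' S' (c' :: 'd \<Rightarrow> 'd \<Rightarrow> 'k) e0' I'"
    and II: "\<And>U. I' U \<longleftrightarrow> I (U \<union> m)"
    and \<phi>: "\<And>x y. \<phi> x y \<noteq> 0 \<Longrightarrow> x \<in> B \<and> y \<in> B' \<and> h x = h' y \<and> S x \<subseteq> S' y \<union> m" "\<phi> e0 e0' = 1"
    "\<And>x y. mat_vec B c (\<lambda>x. \<phi> x y) x = mat_vec B' \<phi> (\<lambda>z. c' z y) x"
  shows "labelled_complex (B <+> B') (case_sum h (\<lambda>y. Suc (h' y))) (case_sum S (\<lambda>y. S' y \<union> m))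
    (cone c c' \<phi>) (Inl e0) (\<lambda>U. I U \<or> m \<subseteq> U)"
    (is "labelled_complex ?B ?h ?S ?c ?e ?I")
proof -
  interpret P: labelled_complex B h S c e0 I by (rule P)
  interpret Q: labelled_complex B' h' S' c' e0' I' by (rule Q)
  note mat_vec_c = mat_vec_cone[OF P.finite_B Q.finite_B]
  have \<phi>_comm: "mat_vec B c (mat_vec B' \<phi> g) x = mat_vec B' \<phi> (mat_vec B' c' g) x" for g x
    unfolding mat_vec_mat_vec \<phi>(3) ..
  have \<phi>_e0: "mat_vec B' \<phi> g e0 = g e0'" for g
  proof -
    have "mat_vec B' \<phi> g e0 = mat_vec B' \<phi> (\<lambda>y. if y = e0' then g e0' else 0) e0"
    proof (rule mat_vec_cong)
      fix y assume "y \<in> B'"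
      then have "\<phi> e0 y = 0" if "y \<noteq> e0'" using \<phi>(1)[of e0 y] P.h_e0 Q.height_zero[of y] that by auto
      then show "\<phi> e0 y * g y = \<phi> e0 y * (if y = e0' then g e0' else 0)" by auto
    qed
    then show ?thesis using mat_vec_delta[OF Q.finite_B Q.e0_in, of \<phi> "g e0'"] \<phi>(2) by simp
  qed
  have c'_e0: "c' z e0' = 0" for z using Q.c_nonzero[of z e0'] Q.h_e0 by auto
  show ?thesis
  proof
    show "finite ?B" "?e \<in> ?B" "?h ?e = 0" "?S ?e = {}"
      using P.finite_B Q.finite_B P.e0_in P.h_e0 P.S_e0 by auto
    show "x = ?e" if "x \<in> ?B" "?h x = 0" for x
      using that P.height_zero by (auto split: sum.splits)
    show "x \<in> ?B \<and> y \<in> ?B \<and> ?h y = Suc (?h x) \<and> ?S x \<subseteq> ?S y" if nz: "?c x y \<noteq> 0" for x y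
    proof (cases x; cases y)
      fix p q assume "x = Inl p" "y = Inl q"
      then show ?thesis using nz P.c_nonzero[of p q] by auto
    next
      fix p q assume "x = Inl p" "y = Inr q"
      then show ?thesis using nz \<phi>(1)[of p q] by auto
    next
      fix p q assume "x = Inr p" "y = Inl q"
      then show ?thesis using nz by simp
    next
      fix p q assume "x = Inr p" "y = Inr q"
      then show ?thesis using nz Q.c_nonzero[of p q] by auto
    qed
    show "mat_vec ?B ?c (\<lambda>y. ?c y z) x = 0" for x z
    proof (cases z; cases x)
      fix p q assume "z = Inr p" "x = Inl q"
      then show ?thesis by (simp add: mat_vec_c mat_vec_minus \<phi>(3))
    qed (simp_all add: mat_vec_c P.square_zero Q.square_zero mat_vec_minus)
    show "\<exists>g. (\<forall>x. g x \<noteq> 0 \<longrightarrow> x \<in> ?B \<and> ?S x \<subseteq> U) \<and> (\<forall>x. mat_vec ?B ?c g x = f x)"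
      if f: "\<And>x. f x \<noteq> 0 \<Longrightarrow> x \<in> ?B \<and> ?S x \<subseteq> U" and f0: "f ?e = 0" and cyc: "\<And>x. mat_vec ?B ?c f x = 0"
      for f U
    proof -
      define p where "p x = f (Inl x)" for x
      define q where "q y = f (Inr y)" for y
      have p: "x \<in> B \<and> S x \<subseteq> U" if "p x \<noteq> 0" for x using f[of "Inl x"] that by (auto simp: p_def)
      have q: "y \<in> B' \<and> S' y \<subseteq> U \<and> m \<subseteq> U" if "q y \<noteq> 0" for y
        using f[of "Inr y"] that by (auto simp: q_def)
      have Dq: "mat_vec B' c' q y = 0" for y using cyc[of "Inr y"] unfolding mat_vec_c q_def by simp
      have Dp: "mat_vec B c p x + mat_vec B' \<phi> q x = 0" for x using cyc[of "Inl x"] unfolding mat_vec_c q_def p_def by simp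
      \<comment> \<open>The second component is solved first. Asking for \<open>g e0' = 0\<close>
        makes the corrected first component vanish at \<open>e0\<close>, as \<open>P.exact\<close>
        requires.\<close>
      have "\<exists>g. (\<forall>y. g y \<noteq> 0 \<longrightarrow> y \<in> B' \<and> S' y \<subseteq> U \<and> m \<subseteq> U) \<and> g e0' = 0 \<and> (\<forall>y. mat_vec B' c' g y = q y)"
      proof (cases "\<forall>y. q y = 0")
        case True
        then show ?thesis by (intro exI[of _ "\<lambda>y. 0"]) simp
      next
        case False
        then have m: "m \<subseteq> U" using q by blast
        have "\<exists>g. (\<forall>y. g y \<noteq> 0 \<longrightarrow> y \<in> B' \<and> S' y \<subseteq> U) \<and> (\<forall>y. mat_vec B' c' g y = q y)"
        proof (cases "q e0' = 0")
          case True
          then show ?thesis using Q.exact[of q U] q Dq by metis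
        next
          case False
          \<comment> \<open>The cycle condition at \<open>e0\<close> says that the boundary of
            \<open>p\<close> there is \<open>- q e0'\<close>. So \<open>p\<close> meets the row of
            \<open>e0\<close> and \<open>I U\<close> holds, hence \<open>I' U\<close>; then some
            column \<open>z\<close> hits \<open>e0'\<close>, and a multiple of it removes the
            coordinate \<open>q e0'\<close>.\<close>
          then have "mat_vec B c p e0 \<noteq> 0" using Dp[of e0] \<phi>_e0 by (metis add.left_neutral)
          then obtain x where x: "c e0 x \<noteq> 0" "p x \<noteq> 0" by (rule mat_vec_nonzero)
          then have "I U" using p P.augmentation by blast
          moreover have "U \<union> m = U" using m by blast
          ultimately have "I' U" using II by simp
          then obtain z where z: "c' e0' z \<noteq> 0" "S' z \<subseteq> U" using Q.augmentation by blast
          have zB: "z \<in> B'" using Q.c_nonzero[OF z(1)] by simp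
          have z_only: "c' y z = 0" if "y \<noteq> e0'" for y
            using Q.c_nonzero[of y z] Q.c_nonzero[OF z(1)] Q.h_e0 Q.height_zero[of y] that by auto
          let ?a = "q e0' / c' e0' z"
          have "\<exists>g. (\<forall>y. g y \<noteq> 0 \<longrightarrow> y \<in> B' \<and> S' y \<subseteq> U) \<and> (\<forall>y. mat_vec B' c' g y = q y - c' y z * ?a)"
          proof (rule Q.exact)
            show "x \<in> B' \<and> S' x \<subseteq> U" if "q x - c' x z * ?a \<noteq> 0" for x
              using q[of x] that Q.c_nonzero[of x z] z by (cases "q x = 0") auto
            show "q e0' - c' e0' z * ?a = 0" using z by simp
            show "mat_vec B' c' (\<lambda>y. q y - c' y z * ?a) x = 0" for x
              unfolding mat_vec_diff mat_vec_scale Dq Q.square_zero by simp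
          qed
          then obtain g where g: "\<forall>y. g y \<noteq> 0 \<longrightarrow> y \<in> B' \<and> S' y \<subseteq> U" "\<forall>y. mat_vec B' c' g y = q y - c' y z * ?a"
            by blast
          have "mat_vec B' c' (\<lambda>y. g y + (if y = z then ?a else 0)) y = q y" for y
            unfolding mat_vec_add mat_vec_delta[OF Q.finite_B zB] using g by simp
          then show ?thesis using g z zB
            by (intro exI[of _ "\<lambda>y. g y + (if y = z then ?a else 0)"]) auto
        qed
        then obtain g where g: "\<forall>y. g y \<noteq> 0 \<longrightarrow> y \<in> B' \<and> S' y \<subseteq> U" "\<forall>y. mat_vec B' c' g y = q y" by blast
        let ?g = "\<lambda>y. if y = e0' then 0 else g y"
        have "mat_vec B' c' ?g y = mat_vec B' c' g y" for y by (rule mat_vec_cong) (simp add: c'_e0)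
        then show ?thesis using g m by (intro exI[of _ ?g]) auto
      qed
      then obtain g where g: "\<And>y. g y \<noteq> 0 \<Longrightarrow> y \<in> B' \<and> S' y \<subseteq> U \<and> m \<subseteq> U" "g e0' = 0"
        "\<And>y. mat_vec B' c' g y = q y" by blast
      have q_eq: "mat_vec B' c' g = q" using g(3) by (intro ext)
      have "\<exists>w. (\<forall>x. w x \<noteq> 0 \<longrightarrow> x \<in> B \<and> S x \<subseteq> U) \<and> (\<forall>x. mat_vec B c w x = p x + mat_vec B' \<phi> g x)"
      proof (rule P.exact)
        show "x \<in> B \<and> S x \<subseteq> U" if "p x + mat_vec B' \<phi> g x \<noteq> 0" for x
        proof (cases "p x = 0")
          case True
          then have "mat_vec B' \<phi> g x \<noteq> 0" using that by simp
          then obtain y where y: "\<phi> x y \<noteq> 0" "g y \<noteq> 0" by (rule mat_vec_nonzero)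
          then show ?thesis using \<phi>(1)[OF y(1)] g(1)[OF y(2)] by blast
        qed (use p in blast)
        show "p e0 + mat_vec B' \<phi> g e0 = 0" using f0 g(2) \<phi>_e0 by (simp add: p_def)
        show "mat_vec B c (\<lambda>x. p x + mat_vec B' \<phi> g x) x = 0" for x
          unfolding mat_vec_add \<phi>_comm q_eq by (rule Dp)
      qed
      then obtain w where w: "\<And>x. w x \<noteq> 0 \<Longrightarrow> x \<in> B \<and> S x \<subseteq> U" "\<And>x. mat_vec B c w x = p x + mat_vec B' \<phi> g x"
        by blast
      let ?g = "case_sum w (\<lambda>y. - g y)"
      have "mat_vec ?B ?c ?g x = f x" for x
        by (cases x) (simp_all add: mat_vec_c mat_vec_minus w(2) g(3) p_def q_def)
      moreover have "x \<in> ?B \<and> ?S x \<subseteq> U" if "?g x \<noteq> 0" for x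
        using that w(1) g(1) by (cases x) auto
      ultimately show ?thesis by blast
    qed
    show "?I U = (\<exists>y. ?c ?e y \<noteq> 0 \<and> ?S y \<subseteq> U)" for U
    proof
      assume "?I U"
      then show "\<exists>y. ?c ?e y \<noteq> 0 \<and> ?S y \<subseteq> U"
      proof
        assume "I U"
        then obtain y where "c e0 y \<noteq> 0" "S y \<subseteq> U" using P.augmentation by blast
        then show ?thesis by (intro exI[of _ "Inl y"]) simp
      next
        assume "m \<subseteq> U"
        then show ?thesis using \<phi>(2) Q.S_e0 by (intro exI[of _ "Inr e0'"]) simp
      qed
    next
      assume "\<exists>y. ?c ?e y \<noteq> 0 \<and> ?S y \<subseteq> U"
      then obtain y where y: "?c ?e y \<noteq> 0" "?S y \<subseteq> U" by blast
      show "?I U"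
      proof (cases y)
        case (Inl a)
        then show ?thesis using y P.augmentation by auto
      next
        case (Inr a)
        then show ?thesis using y by auto
      qed
    qed
  qed
qed

lemma trivial_complex:
  "labelled_complex {e0} (\<lambda>_. 0) (\<lambda>_. {}) (\<lambda>_ _. 0 :: 'k::field) e0 (\<lambda>U. False)"
  by unfold_locales (auto simp: mat_vec_def)

text \<open>A cone lives on a sum type. Moving it to \<open>nat\<close> keeps one index type
  throughout the inductions and under the existential quantifier of
  \<open>bounded_complex\<close>.\<close>

lemma nat_complex:
  assumes "labelled_complex B h S (c :: 'b \<Rightarrow> 'b \<Rightarrow> 'k::field) e0 I"
  shows "\<exists>(B' :: nat set) h' S' (c' :: nat \<Rightarrow> nat \<Rightarrow> 'k) e0'. labelled_complex B' h' S' c' e0' I \<and>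
    (\<forall>y\<in>B'. \<exists>x\<in>B. h' y = h x \<and> S' y = S x) \<and> (\<forall>x\<in>B. \<exists>y\<in>B'. h' y = h x \<and> S' y = S x) \<and>
    (minimal_labels S c \<longrightarrow> minimal_labels S' c')"
proof -
  interpret labelled_complex B h S c e0 I by (rule assms)
  obtain \<alpha> :: "'b \<Rightarrow> nat" where \<alpha>: "inj_on \<alpha> B"
    using finite_B finite_imp_inj_to_nat_seg by blast
  let ?\<beta> = "inv_into B \<alpha>"
  have "?\<beta> y \<in> B" if "y \<in> \<alpha> ` B" for y using that by (rule inv_into_into)
  moreover have "?\<beta> (\<alpha> x) = x" if "x \<in> B" for x using that \<alpha> by simp
  ultimately show ?thesis
    using reindex[OF \<alpha>]
    by (intro exI[of _ "\<alpha> ` B"] exI[of _ "h \<circ> ?\<beta>"] exI[of _ "S \<circ> ?\<beta>"] exI[of _ "\<alpha> e0"]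
        exI[of _ "\<lambda>x y. if x \<in> \<alpha> ` B \<and> y \<in> \<alpha> ` B then c (?\<beta> x) (?\<beta> y) else 0"])
      (auto simp: minimal_labels_def)
qed

text \<open>\<open>card (S x) - h x\<close> is internal minus homological degree, so
  \<open>d\<close> bounds the regularity. The argument \<open>T\<close> fixes the coefficient field,
  which otherwise appears only in the bound variable \<open>c\<close>.\<close>

definition bounded_complex :: "'k::field itself \<Rightarrow> 'v set \<Rightarrow> nat \<Rightarrow> ('v set \<Rightarrow> bool) \<Rightarrow> bool" where
  "bounded_complex T V d I \<longleftrightarrow> (\<exists>(B :: nat set) h S (c :: nat \<Rightarrow> nat \<Rightarrow> 'k) e0.
    labelled_complex B h S c e0 I \<and> (\<forall>x\<in>B. S x \<subseteq> V \<and> card (S x) \<le> h x + d))"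

lemma bounded_complex_cong:
  assumes "bounded_complex T V d I" "\<And>U. I U = I' U"
  shows "bounded_complex T V d I'"
proof -
  have "I = I'" using assms(2) by auto
  then show ?thesis using assms(1) by simp
qed

text \<open>A basis element of the second summand gains 1 in height and at most
  \<open>card m\<close> in degree, which is the origin of \<open>d' + card m \<le> Suc d\<close>. A
  variable satisfies it with \<open>d' = d\<close>, an edge with \<open>d' = d - 1\<close> when
  \<open>d\<close> is positive.\<close>

lemma bounded_complex_cone:
  assumes P: "bounded_complex (T :: 'k::field itself) V d I" and Q: "bounded_complex T V d' (\<lambda>U. I (U \<union> m))"
    and m: "m \<subseteq> V" "d' + card m \<le> Suc d"
  shows "bounded_complex T V d (\<lambda>U. I U \<or> m \<subseteq> U)"
proof -
  obtain B :: "nat set" and h S and c :: "nat \<Rightarrow> nat \<Rightarrow> 'k" and e0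
    where P: "labelled_complex B h S c e0 I" "\<And>x. x \<in> B \<Longrightarrow> S x \<subseteq> V \<and> card (S x) \<le> h x + d"
    using P unfolding bounded_complex_def by metis
  obtain B' :: "nat set" and h' S' and c' :: "nat \<Rightarrow> nat \<Rightarrow> 'k" and e0'
    where Q: "labelled_complex B' h' S' c' e0' (\<lambda>U. I (U \<union> m))"
      "\<And>x. x \<in> B' \<Longrightarrow> S' x \<subseteq> V \<and> card (S' x) \<le> h' x + d'"
    using Q unfolding bounded_complex_def by metis
  obtain \<phi> where \<phi>: "\<And>x y. \<phi> x y \<noteq> 0 \<Longrightarrow> x \<in> B \<and> y \<in> B' \<and> h x = h' y \<and> S x \<subseteq> S' y \<union> m"
    "\<phi> e0 e0' = 1" "\<And>x y. mat_vec B c (\<lambda>x. \<phi> x y) x = mat_vec B' \<phi> (\<lambda>z. c' z y) x"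
    using comparison[OF P(1) Q(1), of m] by metis
  note C = mapping_cone[OF P(1) Q(1) refl \<phi>]
  let ?h = "case_sum h (\<lambda>y. Suc (h' y))" and ?S = "case_sum S (\<lambda>y. S' y \<union> m)"
  have bd: "?S x \<subseteq> V \<and> card (?S x) \<le> ?h x + d" if "x \<in> B <+> B'" for x
  proof (cases x)
    case (Inl p)
    then show ?thesis using P(2)[of p] that by auto
  next
    case (Inr q)
    then have q: "S' q \<subseteq> V" "card (S' q) \<le> h' q + d'" using Q(2)[of q] that by auto
    have "card (S' q \<union> m) \<le> card (S' q) + card m" by (rule card_Un_le)
    then show ?thesis using q m Inr by auto
  qed
  from nat_complex[OF C] obtain B'' :: "nat set" and h'' S'' and c'' :: "nat \<Rightarrow> nat \<Rightarrow> 'k" and e0''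
    where N: "labelled_complex B'' h'' S'' c'' e0'' (\<lambda>U. I U \<or> m \<subseteq> U)"
      "\<And>y. y \<in> B'' \<Longrightarrow> \<exists>x\<in>B <+> B'. h'' y = ?h x \<and> S'' y = ?S x" by blast
  have "S'' y \<subseteq> V \<and> card (S'' y) \<le> h'' y + d" if "y \<in> B''" for y
    using N(2)[OF that] bd by metis
  then show ?thesis using N(1) unfolding bounded_complex_def by blast
qed

text \<open>The ideal collected so far does not involve the next variable \<open>x\<close>, so its
  colon by \<open>x\<close> is the ideal itself and the same bound serves for both parts of the
  cone.\<close>

lemma bounded_complex_add_variables:
  assumes "finite X" "X \<subseteq> V" "bounded_complex T V d I" "\<And>U x. x \<in> X \<Longrightarrow> I (insert x U) = I U"
  shows "bounded_complex T V d (\<lambda>U. I U \<or> U \<inter> X \<noteq> {})"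
  using assms
proof (induction X rule: finite_induct)
  case empty
  then show ?case by simp
next
  case (insert x X)
  let ?I = "\<lambda>U. I U \<or> U \<inter> X \<noteq> {}"
  have IH: "bounded_complex T V d ?I" using insert by simp
  have "?I (U \<union> {x}) = ?I U" for U using insert by auto
  then have "bounded_complex T V d (\<lambda>U. ?I (U \<union> {x}))" using IH by simp
  then have "bounded_complex T V d (\<lambda>U. ?I U \<or> {x} \<subseteq> U)"
    by (rule bounded_complex_cone[OF IH]) (use insert in auto)
  then show ?case by (rule bounded_complex_cong) auto
qed

section \<open>Graphs of boxes\<close>

text \<open>For \<open>U\<close> the support of a monomial, this is membership of the monomial in
  the edge ideal.\<close>

definition edge_family :: "'v set set \<Rightarrow> 'v set \<Rightarrow> bool" where
  "edge_family E U \<longleftrightarrow> (\<exists>e\<in>E. e \<subseteq> U)"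

definition ind_matching :: "'v set set \<Rightarrow> 'v set set \<Rightarrow> bool" where
  "ind_matching E M \<longleftrightarrow> M \<subseteq> E \<and> pairwise disjnt M \<and> {e \<in> E. e \<subseteq> \<Union>M} \<subseteq> M"

text \<open>\<open>{u, v}\<close> is an edge iff the box \<open>[L u, R u] \<times> [D u, T u]\<close> of one of the two vertices
  lies strictly to the left of and above the box of the other. Unlike single points, boxes can be
  enlarged, and this deletes edges one at a time.\<close>

definition box_edges :: "'v set \<Rightarrow> ('v \<Rightarrow> nat) \<Rightarrow> ('v \<Rightarrow> nat) \<Rightarrow> ('v \<Rightarrow> nat) \<Rightarrow> ('v \<Rightarrow> nat) \<Rightarrow> 'v set set" where
  "box_edges V L R D T = {{u, v} | u v. u \<in> V \<and> v \<in> V \<and> R u < L v \<and> T v < D u}"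

text \<open>Injectivity of \<open>T\<close> breaks ties: among the boxes to the right of and below
  the box of \<open>u\<close> exactly one has the largest top, so lowering the bottom of
  \<open>u\<close> to that top destroys a single edge.\<close>

definition box_graph :: "'v set \<Rightarrow> 'v set set \<Rightarrow> bool" where
  "box_graph V E \<longleftrightarrow> finite V \<and> (\<exists>L R D T. inj_on T V \<and> (\<forall>v\<in>V. L v \<le> R v \<and> D v \<le> T v) \<and> E = box_edges V L R D T)"

lemma box_graph_edge:
  assumes "box_graph V E" "e \<in> E"
  obtains u v where "e = {u, v}" "u \<noteq> v" "u \<in> V" "v \<in> V"
proof -
  obtain L R D T where E: "\<forall>v\<in>V. L v \<le> R v \<and> D v \<le> T v" "E = box_edges V L R D T"
    using assms unfolding box_graph_def by blast
  then obtain u v where "e = {u, v}" "u \<in> V" "v \<in> V" "R u < L v"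
    using assms(2) by (auto simp: box_edges_def)
  then show ?thesis using E that[of u v] by force
qed

lemma box_graph_finite: "box_graph V E \<Longrightarrow> finite E"
  by (rule finite_subset[of _ "Pow V"]) (force elim: box_graph_edge, simp add: box_graph_def)

lemma box_graph_restrict:
  assumes "box_graph V E"
  shows "box_graph (V - N) {e \<in> E. e \<inter> N = {}}"
proof -
  obtain L R D T where E: "finite V" "inj_on T V" "\<forall>v\<in>V. L v \<le> R v \<and> D v \<le> T v" "E = box_edges V L R D T"
    using assms unfolding box_graph_def by blast
  have "{e \<in> E. e \<inter> N = {}} = box_edges (V - N) L R D T"
    unfolding E(4) box_edges_def by blast
  moreover have "inj_on T (V - N)" using E(2) by (rule inj_on_diff)
  ultimately show ?thesis using E unfolding box_graph_def
    by (intro conjI exI[of _ L] exI[of _ R] exI[of _ D] exI[of _ T]) auto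
qed

lemma finite_has_max:
  fixes f :: "'a \<Rightarrow> nat"
  assumes "finite A" "A \<noteq> {}"
  shows "\<exists>x\<in>A. \<forall>y\<in>A. f y \<le> f x"
proof -
  have "Max (f ` A) \<in> f ` A" using assms by (intro Max_in) auto
  then obtain x where "x \<in> A" "f x = Max (f ` A)" by auto
  then show ?thesis using assms by (intro bexI[of _ x]) auto
qed

text \<open>The chosen edge is not the middle edge of an induced path on four vertices, so deleting it
  creates no new induced matching.\<close>

lemma box_graph_good_edge:
  assumes "box_graph V E" "E \<noteq> {}"
  obtains e where "e \<in> E" "box_graph V (E - {e})" "\<And>M. ind_matching (E - {e}) M \<Longrightarrow> ind_matching E M"
proof -
  obtain L R D T where E: "finite V" "inj_on T V" "\<And>v. v \<in> V \<Longrightarrow> L v \<le> R v \<and> D v \<le> T v"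
    "E = box_edges V L R D T"
    using assms unfolding box_graph_def by blast
  define lt where "lt u v \<longleftrightarrow> u \<in> V \<and> v \<in> V \<and> R u < L v \<and> T v < D u" for u v
  have E_lt: "E = {{u, v} | u v. lt u v}" unfolding E(4) box_edges_def lt_def by simp
  have irrefl: "\<not> lt u u" for u using E(3)[of u] by (auto simp: lt_def)
  have trans: "lt u w" if "lt u v" "lt v w" for u v w
    using that E(3)[of v] by (auto simp: lt_def)
  have edge_iff: "{u, v} \<in> E \<longleftrightarrow> lt u v \<or> lt v u" for u v
    unfolding E_lt by (auto simp: doubleton_eq_iff)
  define A where "A = {u. \<exists>v. lt u v}"
  have "finite A" "A \<noteq> {}" using E(1) assms(2)
    by (auto simp: A_def lt_def E_lt intro: finite_subset[of _ V])
  then have "\<exists>u\<in>A. \<forall>w\<in>A. R w \<le> R u"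
    by (rule finite_has_max)
  \<comment> \<open>\<open>u\<close> reaches furthest to the right among the vertices that precede
    something, and \<open>v\<close> will have the highest top among those that \<open>u\<close>
    precedes. On an induced path \<open>u'\<close>, \<open>u\<close>, \<open>v\<close>,
    \<open>v'\<close> transitivity would give \<open>lt u u'\<close> and \<open>lt v' v\<close>.
    Then \<open>R v' \<le> R u < L u'\<close> and \<open>T u' \<le> T v < D v'\<close> yield
    \<open>lt v' u'\<close>, a chord.\<close>
  then obtain u where u: "u \<in> A" "\<And>w. w \<in> A \<Longrightarrow> R w \<le> R u" by blast
  define Up where "Up = {v. lt u v}"
  have "finite Up" "Up \<noteq> {}" using E(1) u by (auto simp: A_def lt_def Up_def intro: finite_subset[of _ V])
  then have "\<exists>v\<in>Up. \<forall>w\<in>Up. T w \<le> T v"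
    by (rule finite_has_max)
  then obtain v where v: "lt u v" "\<And>w. lt u w \<Longrightarrow> T w \<le> T v" by (auto simp: Up_def)
  let ?e = "{u, v}"
  have uv: "u \<noteq> v" using v irrefl by auto
  have "?e \<in> E" using v edge_iff by simp
  moreover have "box_graph V (E - {?e})"
  proof -
    \<comment> \<open>The box of \<open>u\<close> grows downwards to the height \<open>T v\<close>.
      Every other \<open>y\<close> with \<open>lt u y\<close> has \<open>T y < T v\<close> and stays
      adjacent to \<open>u\<close>.\<close>
    let ?D = "D(u := T v)"
    have lt': "(x \<in> V \<and> y \<in> V \<and> R x < L y \<and> T y < ?D x) \<longleftrightarrow> lt x y \<and> (x, y) \<noteq> (u, v)" for x y
    proof (cases "x = u")
      case True
      have "T y < T v" if "lt u y" "y \<noteq> v"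
        using v(2)[OF that(1)] that v(1) E(2) by (metis inj_onD le_neq_implies_less lt_def)
      then show ?thesis using True v(1) by (auto simp: lt_def)
    qed (auto simp: lt_def)
    have "\<not> lt v u" using trans[OF v(1)] irrefl by blast
    then have "{x, y} \<noteq> ?e \<longleftrightarrow> (x, y) \<noteq> (u, v)" if "lt x y" for x y
      using that by (metis doubleton_eq_iff prod.inject)
    then have "{{x, y} | x y. lt x y \<and> (x, y) \<noteq> (u, v)} = {{x, y} | x y. lt x y \<and> {x, y} \<noteq> ?e}"
      by (metis (lifting))
    also have "\<dots> = E - {?e}" unfolding E_lt by auto
    finally have "E - {?e} = box_edges V L R ?D T"
      unfolding box_edges_def lt' by (rule sym)
    moreover have "?D w \<le> T w" if "w \<in> V" for w
      using E(3)[OF that] v(1) by (auto simp: lt_def)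
    ultimately show ?thesis using E unfolding box_graph_def by blast
  qed
  moreover have "ind_matching E M" if M: "ind_matching (E - {?e}) M" for M
  proof -
    have ME: "M \<subseteq> E - {?e}" and dis: "pairwise disjnt M" and ind: "\<And>e. e \<in> E \<Longrightarrow> e \<noteq> ?e \<Longrightarrow> e \<subseteq> \<Union>M \<Longrightarrow> e \<in> M"
      using M by (auto simp: ind_matching_def)
    \<comment> \<open>Only \<open>?e\<close> itself could prevent an induced matching of the smaller
      graph from being induced in \<open>E\<close>.\<close>
    have "\<not> ?e \<subseteq> \<Union>M"
    proof
      assume sub: "?e \<subseteq> \<Union>M"
      then obtain e1 e2 where e: "e1 \<in> M" "u \<in> e1" "e2 \<in> M" "v \<in> e2" by auto
      obtain u' where u': "e1 = {u, u'}" using e ME unfolding E_lt by blast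
      obtain v' where v': "e2 = {v, v'}" using e ME unfolding E_lt by blast
      have "e1 \<noteq> e2"
      proof
        assume "e1 = e2"
        then have "e1 = ?e" using e u' v' uv by auto
        then show False using e ME by auto
      qed
      then have disj: "e1 \<inter> e2 = {}" using dis e by (auto simp: pairwise_def disjnt_def)
      have nadj: "{x, y} \<notin> E" if "x \<in> e1" "y \<in> e2" "{x, y} \<noteq> ?e" for x y
      proof
        assume xy: "{x, y} \<in> E"
        then have "{x, y} \<in> M" using ind that e by blast
        have uniq: "a = b" if "a \<in> M" "b \<in> M" "z \<in> a" "z \<in> b" for a b z
          using dis that unfolding pairwise_def disjnt_def by blast
        have "{x, y} = e1" using \<open>{x, y} \<in> M\<close> e(1) that(1) uniq[of "{x, y}" e1 x] by simp
        moreover have "{x, y} = e2" using \<open>{x, y} \<in> M\<close> e(3) that(2) uniq[of "{x, y}" e2 y] by simp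
        ultimately show False using \<open>e1 \<noteq> e2\<close> by simp
      qed
      have ne: "u' \<noteq> v" "v' \<noteq> u" "u' \<noteq> u" "v' \<noteq> v"
        using disj u' v' e ME irrefl edge_iff[of u u] edge_iff[of v v] by auto
      have "\<not> lt u' v" "\<not> lt u v'" "\<not> lt v' u'" "\<not> lt v u'" "\<not> lt v' u"
        using nadj[of u' v] nadj[of u v'] nadj[of u' v'] u' v' ne uv edge_iff
        by (auto simp: doubleton_eq_iff)
      moreover have "lt u u' \<or> lt u' u" "lt v v' \<or> lt v' v" using e ME u' v' edge_iff by auto
      ultimately have N: "lt u u'" "lt v' v" "\<not> lt v' u'" using trans v(1) by blast+
      have "v' \<in> A" using N(2) by (auto simp: A_def)
      then have "R v' < L u'" using u(2)[of v'] N(1) by (auto simp: lt_def)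
      moreover have "T u' < D v'" using v(2)[OF N(1)] N(2) by (auto simp: lt_def)
      ultimately show False using N by (auto simp: lt_def)
    qed
    then show ?thesis using ME dis ind unfolding ind_matching_def by blast
  qed
  ultimately show ?thesis by (rule that)
qed

text \<open>The label set \<open>V'\<close> stays fixed in the induction because the complex for
  \<open>E'\<close>, a graph on \<open>V - N\<close>, gets the variables in \<open>N - e\<close>
  adjoined afterwards.\<close>

lemma box_graph_bounded_complex:
  assumes "box_graph V E" "V \<subseteq> V'" "finite V'" "\<And>M. ind_matching E M \<Longrightarrow> card M \<le> d"
  shows "bounded_complex (T :: 'k::field itself) V' d (edge_family E)"
  using assms
proof (induction "card E" arbitrary: V E d rule: less_induct)
  case less
  have finE: "finite E" using less.prems(1) by (rule box_graph_finite)
  show ?case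
  proof (cases "E = {}")
    case True
    have "bounded_complex T V' d (\<lambda>U. False)"
      unfolding bounded_complex_def using trivial_complex[of "0::nat", where ?'k = 'k] by fastforce
    then show ?thesis by (rule bounded_complex_cong) (simp add: True edge_family_def)
  next
    case False
    obtain e where e: "e \<in> E" "box_graph V (E - {e})" "\<And>M. ind_matching (E - {e}) M \<Longrightarrow> ind_matching E M"
      using box_graph_good_edge[OF less.prems(1) False] by blast
    have lt: "card (E - {e}) < card E" using e finE by (intro psubset_card_mono) auto
    have P: "bounded_complex T V' d (edge_family (E - {e}))"
      by (rule less.hyps[OF lt e(2)]) (use less.prems e in auto)
    \<comment> \<open>\<open>N\<close> is the closed neighbourhood of the two ends of
      \<open>e\<close>.\<close>
    define N where "N = \<Union>{e' \<in> E. e' \<inter> e \<noteq> {}}"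
    define E' where "E' = {e' \<in> E. e' \<inter> N = {}}"
    obtain u v where uv: "e = {u, v}" "u \<noteq> v" "u \<in> V" "v \<in> V" using box_graph_edge[OF less.prems(1) e(1)] .
    have eN: "e \<subseteq> N" using e uv by (auto simp: N_def)
    have e_notin: "e \<notin> E'" using eN uv by (auto simp: E'_def)
    have ltE': "card E' < card E"
      using e(1) e_notin finE by (intro psubset_card_mono) (auto simp: E'_def)
    have extend: "ind_matching E (insert e M) \<and> e \<notin> M" if M: "ind_matching E' M" for M
    proof -
      have ME': "M \<subseteq> E'" and dis: "pairwise disjnt M" and ind: "\<And>e. e \<in> E' \<Longrightarrow> e \<subseteq> \<Union>M \<Longrightarrow> e \<in> M"
        using M by (auto simp: ind_matching_def)
      have MN: "x \<notin> N" if "x \<in> e'" "e' \<in> M" for x e' using ME' that by (auto simp: E'_def)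
      have "e' \<in> insert e M" if e': "e' \<in> E" "e' \<subseteq> \<Union>(insert e M)" for e'
      proof (cases "e' \<inter> e = {}")
        case True
        then have "e' \<subseteq> \<Union>M" using e' by auto
        moreover have "e' \<in> E'" using e' calculation MN by (auto simp: E'_def)
        ultimately show ?thesis using ind by simp
      next
        case False
        then have "e' \<subseteq> N" using e' by (auto simp: N_def)
        then have "e' \<subseteq> e" using e' MN by auto
        moreover obtain x y where "e' = {x, y}" "x \<noteq> y" using box_graph_edge[OF less.prems(1) e'(1)] .
        ultimately show ?thesis using uv by auto
      qed
      moreover have "pairwise disjnt (insert e M)"
        using dis MN eN by (auto simp: pairwise_insert disjnt_def)
      moreover have "e \<notin> M" using e_notin ME' by auto
      ultimately show ?thesis using e(1) ME' unfolding ind_matching_def E'_def by blast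
    qed
    have card_le: "Suc (card M) \<le> d" if M: "ind_matching E' M" for M
    proof -
      have "finite M" using M finE by (auto simp: ind_matching_def E'_def intro: finite_subset)
      then show ?thesis using extend[OF M] less.prems(4)[of "insert e M"] by simp
    qed
    \<comment> \<open>Adding \<open>e\<close> to the empty matching already shows
      \<open>1 \<le> d\<close>, so \<open>d - 1\<close> below is a true subtraction.\<close>
    have "ind_matching E' {}"
      using less.prems(1) by (auto simp: ind_matching_def E'_def elim: box_graph_edge)
    then have d: "1 \<le> d" using card_le[of "{}"] by simp
    have "bounded_complex T V' (d - 1) (edge_family E')"
    proof (rule less.hyps[OF ltE'])
      show "box_graph (V - N) E'" unfolding E'_def by (rule box_graph_restrict[OF less.prems(1)])
      show "card M \<le> d - 1" if "ind_matching E' M" for M using card_le[OF that] by simp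
    qed (use less.prems in auto)
    moreover have "N - e \<subseteq> V'" using less.prems(1,2) by (auto simp: N_def elim: box_graph_edge)
    moreover have "edge_family E' (insert x U) = edge_family E' U" if "x \<in> N - e" for x U
      using that unfolding edge_family_def E'_def by blast
    ultimately have "bounded_complex T V' (d - 1) (\<lambda>U. edge_family E' U \<or> U \<inter> (N - e) \<noteq> {})"
      using less.prems(3) by (intro bounded_complex_add_variables) (auto intro: finite_subset)
    \<comment> \<open>The colon by \<open>e\<close>: an edge that meets \<open>e\<close> in one
      vertex contributes its other end as a variable, and these ends are exactly
      \<open>N - e\<close>. An edge disjoint from \<open>e\<close> lies in \<open>E'\<close> or
      already contains such a variable.\<close>
    then have Q: "bounded_complex T V' (d - 1) (\<lambda>U. edge_family (E - {e}) (U \<union> e))"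
    proof (rule bounded_complex_cong)
      fix U
      show "(edge_family E' U \<or> U \<inter> (N - e) \<noteq> {}) = edge_family (E - {e}) (U \<union> e)"
      proof
        assume "edge_family E' U \<or> U \<inter> (N - e) \<noteq> {}"
        then show "edge_family (E - {e}) (U \<union> e)"
        proof
          assume "edge_family E' U"
          then show ?thesis using e_notin unfolding edge_family_def E'_def by blast
        next
          assume "U \<inter> (N - e) \<noteq> {}"
          then obtain w e' where w: "w \<in> U" "w \<notin> e" "e' \<in> E" "w \<in> e'" "e' \<inter> e \<noteq> {}"
            by (auto simp: N_def)
          then obtain x y where "e' = {x, y}" using box_graph_edge[OF less.prems(1)] by metis
          then have "e' \<subseteq> U \<union> e" using w by auto
          then show ?thesis using w unfolding edge_family_def by blast
        qed
      next
        assume "edge_family (E - {e}) (U \<union> e)"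
        then obtain e' where e': "e' \<in> E" "e' \<noteq> e" "e' \<subseteq> U \<union> e" by (auto simp: edge_family_def)
        obtain x y where xy: "e' = {x, y}" "x \<noteq> y" using box_graph_edge[OF less.prems(1) e'(1)] .
        show "edge_family E' U \<or> U \<inter> (N - e) \<noteq> {}"
        proof (cases "e' \<inter> e = {}")
          case True
          then have "e' \<subseteq> U" using e' by auto
          then show ?thesis using True e'(1) unfolding edge_family_def E'_def by blast
        next
          case False
          then have "e' \<subseteq> N" using e' by (auto simp: N_def)
          moreover have "\<not> e' \<subseteq> e" using e' xy uv by auto
          ultimately show ?thesis using e' by blast
        qed
      qed
    qed
    have "bounded_complex T V' d (\<lambda>U. edge_family (E - {e}) U \<or> e \<subseteq> U)"
      by (rule bounded_complex_cone[OF P Q]) (use uv less.prems d in auto)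
    then show ?thesis by (rule bounded_complex_cong) (use e(1) in \<open>auto simp: edge_family_def\<close>)
  qed
qed

section \<open>Uniqueness of minimal resolutions\<close>

abbreviation coeff :: "('v, 'k::field) mpoly \<Rightarrow> ('v \<Rightarrow>\<^sub>0 nat) \<Rightarrow> 'k" where
  "coeff \<equiv> Poly_Mapping.lookup"

abbreviation monomial :: "('v \<Rightarrow>\<^sub>0 nat) \<Rightarrow> 'k::field \<Rightarrow> ('v, 'k) mpoly" where
  "monomial \<equiv> Poly_Mapping.single"

section \<open>Coefficients, degrees and homogeneous components of polynomials\<close>

lemma lookup_sum': "Poly_Mapping.lookup (sum f A) t = (\<Sum>a\<in>A. Poly_Mapping.lookup (f a) t)"
  by (induction A rule: infinite_finite_induct) (auto simp: lookup_add)

lemma sum_monomials: "(\<Sum>t\<in>Poly_Mapping.keys p. monomial t (coeff p t)) = p"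
  by (rule poly_mapping_eqI)
    (simp add: lookup_sum' lookup_single when_def in_keys_iff sum.delta cong: if_cong)

lemma coeff_monomial_mult: "coeff (monomial a c * p) (a + t) = c * coeff p t"
proof -
  have "monomial a c * p = (\<Sum>u\<in>Poly_Mapping.keys p. monomial (a + u) (c * coeff p u))"
    by (subst (1) sum_monomials[of p, symmetric]) (simp only: sum_distrib_left mult_single)
  then show ?thesis
    by (simp add: lookup_sum' lookup_single when_def in_keys_iff sum.delta cong: if_cong)
qed

lemma coeff_monomial_mult_eq_0: "(\<And>u. t \<noteq> a + u) \<Longrightarrow> coeff (monomial a c * p) t = 0"
  using keys_mult[of "monomial a c" p] by (fastforce simp: in_keys_iff lookup_single when_def split: if_splits)

text \<open>A product of monomials is 1 only if both factors are. The constant term is the reduction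
  modulo the irrelevant ideal, under which the differentials of a minimal resolution vanish.\<close>

lemma coeff_mult_0:
  fixes p q :: "('v, 'k::field) mpoly"
  shows "coeff (p * q) 0 = coeff p 0 * coeff q 0"
proof -
  have *: "coeff (monomial a c * q) 0 = (if a = 0 then c * coeff q 0 else 0)" for a :: "'v \<Rightarrow>\<^sub>0 nat" and c
  proof (cases "a = 0")
    case True
    then show ?thesis using coeff_monomial_mult[of 0 c q 0] by simp
  next
    case False
    then have "0 \<noteq> a + u" for u by (metis add_eq_0_iff_both_eq_0 lookup_add lookup_zero poly_mapping_eqI)
    then show ?thesis using False by (simp add: coeff_monomial_mult_eq_0)
  qed
  have "coeff (p * q) 0 = coeff ((\<Sum>t\<in>Poly_Mapping.keys p. monomial t (coeff p t)) * q) 0"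
    by (simp add: sum_monomials)
  also have "\<dots> = (\<Sum>t\<in>Poly_Mapping.keys p. if t = 0 then coeff p t * coeff q 0 else 0)"
    by (simp add: sum_distrib_right lookup_sum' *)
  also have "\<dots> = coeff p 0 * coeff q 0"
    by (simp add: sum.delta in_keys_iff)
  finally show ?thesis .
qed

lemma keys_add_nat: "Poly_Mapping.keys (s + t) = Poly_Mapping.keys s \<union> Poly_Mapping.keys (t :: 'v \<Rightarrow>\<^sub>0 nat)"
  by (auto simp: in_keys_iff lookup_add)

lemma mon_degree_add: "mon_degree (s + t) = mon_degree s + mon_degree t"
proof -
  let ?A = "Poly_Mapping.keys s \<union> Poly_Mapping.keys t"
  have *: "mon_degree u = (\<Sum>v\<in>?A. Poly_Mapping.lookup u v)" if "Poly_Mapping.keys u \<subseteq> ?A" for u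
    unfolding mon_degree_def by (rule sum.mono_neutral_left) (use that in \<open>auto simp: in_keys_iff\<close>)
  show ?thesis
    using *[of "s + t"] *[of s] *[of t] by (simp add: keys_add_nat lookup_add sum.distrib)
qed

lemma poly_ring_0 [simp]: "0 \<in> poly_ring V" and poly_ring_1 [simp]: "1 \<in> poly_ring V"
  by (auto simp: poly_ring_def)

lemma poly_ring_add: "p \<in> poly_ring V \<Longrightarrow> q \<in> poly_ring V \<Longrightarrow> p + q \<in> poly_ring V"
  using Poly_Mapping.keys_add[of p q] by (auto simp: poly_ring_def)

lemma poly_ring_uminus: "p \<in> poly_ring V \<Longrightarrow> - p \<in> poly_ring V"
  by (simp add: poly_ring_def)

lemma poly_ring_diff: "p \<in> poly_ring V \<Longrightarrow> q \<in> poly_ring V \<Longrightarrow> p - q \<in> poly_ring V"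
  using poly_ring_add[of p V "- q"] poly_ring_uminus[of q V] by simp

lemma poly_ring_mult: "p \<in> poly_ring V \<Longrightarrow> q \<in> poly_ring V \<Longrightarrow> p * q \<in> poly_ring V"
  using keys_mult[of p q] by (fastforce simp: poly_ring_def keys_add_nat)

lemma poly_ring_sum: "(\<And>x. x \<in> A \<Longrightarrow> f x \<in> poly_ring V) \<Longrightarrow> sum f A \<in> poly_ring V"
  by (induction A rule: infinite_finite_induct) (auto intro: poly_ring_add)

lemma poly_ring_mat_vec:
  "(\<And>y. y \<in> B \<Longrightarrow> c x y \<in> poly_ring V) \<Longrightarrow> (\<And>y. y \<in> B \<Longrightarrow> f y \<in> poly_ring V) \<Longrightarrow> mat_vec B c f x \<in> poly_ring V"
  unfolding mat_vec_def by (intro poly_ring_sum poly_ring_mult) auto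

lemma homogeneous_mult: "homogeneous d p \<Longrightarrow> homogeneous e q \<Longrightarrow> homogeneous (d + e) (p * q)"
  using keys_mult[of p q] by (force simp: homogeneous_def mon_degree_add)

lemma homogeneous_add: "homogeneous d p \<Longrightarrow> homogeneous d q \<Longrightarrow> homogeneous d (p + q)"
  using Poly_Mapping.keys_add[of p q] by (auto simp: homogeneous_def)

lemma homogeneous_0 [simp]: "homogeneous d 0"
  by (simp add: homogeneous_def)

lemma homogeneous_sum: "(\<And>x. x \<in> A \<Longrightarrow> homogeneous d (f x)) \<Longrightarrow> homogeneous d (sum f A)"
  by (induction A rule: infinite_finite_induct) (auto intro: homogeneous_add)

definition hom_component :: "int \<Rightarrow> ('v, 'k::field) mpoly \<Rightarrow> ('v, 'k) mpoly" where
  "hom_component d p = (\<Sum>t\<in>{t \<in> Poly_Mapping.keys p. int (mon_degree t) = d}. monomial t (coeff p t))"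

lemma coeff_hom_component: "coeff (hom_component d p) t = (if int (mon_degree t) = d then coeff p t else 0)"
  by (simp add: hom_component_def lookup_sum' lookup_single when_def in_keys_iff sum.delta cong: if_cong)

lemma homogeneous_hom_component: "homogeneous d (hom_component d p)"
  by (auto simp: homogeneous_def in_keys_iff coeff_hom_component split: if_splits)

lemma poly_ring_hom_component: "p \<in> poly_ring V \<Longrightarrow> hom_component d p \<in> poly_ring V"
  by (auto simp: poly_ring_def in_keys_iff coeff_hom_component split: if_splits)

lemma hom_component_homogeneous:
  "homogeneous e p \<Longrightarrow> hom_component d p = (if d = e then p else 0)"
  by (rule poly_mapping_eqI) (auto simp: homogeneous_def in_keys_iff coeff_hom_component)

lemma hom_component_sum: "hom_component d (sum f A) = (\<Sum>x\<in>A. hom_component d (f x))"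
  by (rule poly_mapping_eqI) (simp add: coeff_hom_component lookup_sum')

lemma hom_component_mult:
  assumes "homogeneous d p"
  shows "hom_component e (p * q) = p * hom_component (e - d) q"
proof -
  have "hom_component e (p * q) = hom_component e (p * (\<Sum>t\<in>Poly_Mapping.keys q. monomial t (coeff q t)))"
    by (simp add: sum_monomials)
  also have "\<dots> = (\<Sum>t\<in>Poly_Mapping.keys q. hom_component e (p * monomial t (coeff q t)))"
    by (simp add: sum_distrib_left hom_component_sum)
  also have "\<dots> = (\<Sum>t\<in>Poly_Mapping.keys q. if e = d + int (mon_degree t) then p * monomial t (coeff q t) else 0)"
    by (intro sum.cong refl hom_component_homogeneous homogeneous_mult assms)
      (auto simp: homogeneous_def)
  also have "\<dots> = (\<Sum>t\<in>{t \<in> Poly_Mapping.keys q. int (mon_degree t) = e - d}. p * monomial t (coeff q t))"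
    by (rule sum.mono_neutral_cong_right) auto
  also have "\<dots> = p * hom_component (e - d) q"
    by (simp add: hom_component_def sum_distrib_left)
  finally show ?thesis .
qed

lemma coeff_0_irrelevant: "p \<in> ideal_generated V (var ` V) \<Longrightarrow> coeff p 0 = 0"
proof -
  have "coeff (var v :: ('a, 'b) mpoly) 0 = 0" for v
  proof -
    have "Poly_Mapping.lookup (Poly_Mapping.single v (1::nat)) v \<noteq> 0" by simp
    then have "Poly_Mapping.single v (1::nat) \<noteq> 0" by (metis lookup_zero)
    then show ?thesis by (simp add: var_def lookup_single when_def)
  qed
  then show "p \<in> ideal_generated V (var ` V) \<Longrightarrow> coeff p 0 = 0"
    by (fastforce simp: ideal_generated_def lookup_sum' coeff_mult_0 intro!: sum.neutral)
qed

text \<open>Rows beyond the rank are arbitrary in \<open>entry\<close>; setting them to zero makes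
  the columns below the rank of the source elements of \<open>free_module\<close>.\<close>

definition diff_matrix :: "('v, 'k::field) graded_free_seq \<Rightarrow> nat \<Rightarrow> nat \<Rightarrow> nat \<Rightarrow> ('v, 'k) mpoly" where
  "diff_matrix F i r s = (if r < rank F i then entry F i r s else 0)"

lemma differential_eq: "differential F i f = mat_vec {..<rank F (Suc i)} (diff_matrix F i) f"
  by (rule ext) (simp add: differential_def mat_vec_def diff_matrix_def)

definition boundaries :: "'v set \<Rightarrow> ('v, 'k::field) graded_free_seq \<Rightarrow> nat \<Rightarrow> (nat \<Rightarrow> ('v, 'k) mpoly) set" where
  "boundaries V F i = differential F i ` free_module V F (Suc i)"

lemma boundariesE:
  assumes "v \<in> boundaries V F i"
  obtains w where "w \<in> free_module V F (Suc i)" "mat_vec {..<rank F (Suc i)} (diff_matrix F i) w = v"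
  using assms by (auto simp: boundaries_def differential_eq)

lemma free_module_poly_ring: "f \<in> free_module V F i \<Longrightarrow> f r \<in> poly_ring V"
  by (cases "r < rank F i") (auto simp: free_module_def)

lemma free_moduleI:
  "(\<And>r. r < rank F i \<Longrightarrow> f r \<in> poly_ring V) \<Longrightarrow> (\<And>r. r \<ge> rank F i \<Longrightarrow> f r = 0) \<Longrightarrow> f \<in> free_module V F i"
  by (simp add: free_module_def)

lemma free_module_0: "f \<in> free_module V F i \<Longrightarrow> r \<ge> rank F i \<Longrightarrow> f r = 0"
  by (simp add: free_module_def)

lemma free_module_diff:
  "f \<in> free_module V F i \<Longrightarrow> g \<in> free_module V F i \<Longrightarrow> (\<lambda>r. f r - g r) \<in> free_module V F i"
  by (auto simp: free_module_def intro: poly_ring_diff)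

lemma free_module_mat_vec:
  assumes "\<And>s. s < n \<Longrightarrow> (\<lambda>r. \<phi> r s) \<in> free_module V F i" "\<And>s. s < n \<Longrightarrow> f s \<in> poly_ring V"
  shows "mat_vec {..<n} \<phi> f \<in> free_module V F i"
proof (rule free_moduleI)
  show "mat_vec {..<n} \<phi> f r \<in> poly_ring V" for r
    by (rule poly_ring_mat_vec) (use assms free_module_poly_ring in force)+
  show "mat_vec {..<n} \<phi> f r = 0" if "r \<ge> rank F i" for r
    by (rule mat_vec_rows_zero) (use assms(1) free_module_0 that in force)
qed

lemma free_module_delta: "s < rank F i \<Longrightarrow> (\<lambda>r. if r = s then 1 else 0) \<in> free_module V F i"
  by (auto simp: free_module_def)

section \<open>Lifts, homotopies and chain maps for minimal resolutions\<close>

locale resolution =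
  fixes V :: "'v set" and I :: "('v, 'k::field) mpoly set" and F :: "('v, 'k) graded_free_seq"
  assumes res: "minimal_graded_free_resolution V I F"
begin

abbreviation "d \<equiv> diff_matrix F"

lemma rank_0: "rank F 0 = 1" "gdeg F 0 0 = 0"
  using res by (auto simp: minimal_graded_free_resolution_def)

lemma column: "s < rank F (Suc i) \<Longrightarrow> (\<lambda>r. d i r s) \<in> free_module V F i"
  using res by (auto simp: minimal_graded_free_resolution_def free_module_def diff_matrix_def)

lemma homogeneous_d: "s < rank F (Suc i) \<Longrightarrow> homogeneous (gdeg F (Suc i) s - gdeg F i r) (d i r s)"
  using res by (auto simp: minimal_graded_free_resolution_def diff_matrix_def)

lemma coeff_d_0: "s < rank F (Suc i) \<Longrightarrow> coeff (d i r s) 0 = 0"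
  using res coeff_0_irrelevant[of "entry F i r s" V]
  by (simp add: minimal_graded_free_resolution_def diff_matrix_def)

text \<open>The module in degree 0 has rank 1, so a vector in it is determined by its coordinate at
  0.\<close>

lemma boundaries_0: "v \<in> free_module V F 0 \<Longrightarrow> v \<in> boundaries V F 0 \<longleftrightarrow> v 0 \<in> I"
proof -
  have I: "(\<lambda>f. f 0) ` boundaries V F 0 = I"
    using res by (simp add: minimal_graded_free_resolution_def boundaries_def)
  assume v: "v \<in> free_module V F 0"
  show ?thesis
  proof
    assume "v 0 \<in> I"
    then obtain w where w: "w \<in> boundaries V F 0" "w 0 = v 0" unfolding I[symmetric] by auto
    have "w r = v r" for r
      using w rank_0 v by (cases "r = 0") (auto simp: boundaries_def differential_def free_module_def)
    then have "w = v" by (rule ext)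
    then show "v \<in> boundaries V F 0" using w by simp
  qed (use I in auto)
qed

lemma boundaries_Suc:
  "v \<in> boundaries V F (Suc i) \<longleftrightarrow>
    v \<in> free_module V F (Suc i) \<and> (\<forall>r. mat_vec {..<rank F (Suc i)} (d i) v r = 0)"
proof -
  have "boundaries V F (Suc i) = {f \<in> free_module V F (Suc i). differential F i f = (\<lambda>r. 0)}"
    using res by (simp add: minimal_graded_free_resolution_def boundaries_def)
  then show ?thesis by (auto simp: differential_eq fun_eq_iff)
qed

lemma column_boundary: "s < rank F (Suc i) \<Longrightarrow> (\<lambda>r. d i r s) \<in> boundaries V F i"
proof -
  assume s: "s < rank F (Suc i)"
  have "differential F i (\<lambda>r. if r = s then 1 else 0) = (\<lambda>r. d i r s)"
    unfolding differential_eq by (rule ext, subst mat_vec_delta) (use s in auto)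
  then show ?thesis using free_module_delta[OF s] unfolding boundaries_def by (metis image_eqI)
qed

lemma d_d: "s < rank F (Suc (Suc i)) \<Longrightarrow> mat_vec {..<rank F (Suc i)} (d i) (\<lambda>r. d (Suc i) r s) r = 0"
  using column_boundary boundaries_Suc by blast

text \<open>Any preimage can be made homogeneous: as the entries of \<open>d\<close> are
  homogeneous, cutting coordinate \<open>s\<close> down to degree
  \<open>\<delta> - gdeg F (Suc i) s\<close> cuts coordinate \<open>r\<close> of the image down to
  degree \<open>\<delta> - gdeg F i r\<close>, which leaves \<open>v\<close> unchanged.\<close>

lemma homogeneous_lift:
  assumes "v \<in> boundaries V F i" "\<And>r. r < rank F i \<Longrightarrow> homogeneous (\<delta> - gdeg F i r) (v r)"
  shows "\<exists>w\<in>free_module V F (Suc i). mat_vec {..<rank F (Suc i)} (d i) w = v \<and>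
    (\<forall>s. homogeneous (\<delta> - gdeg F (Suc i) s) (w s))"
proof -
  obtain w where w: "w \<in> free_module V F (Suc i)" "mat_vec {..<rank F (Suc i)} (d i) w = v"
    using assms(1) by (rule boundariesE)
  let ?w = "\<lambda>s. hom_component (\<delta> - gdeg F (Suc i) s) (w s)"
  have "?w \<in> free_module V F (Suc i)"
    using w(1) by (auto simp: free_module_def poly_ring_hom_component hom_component_homogeneous)
  moreover have "mat_vec {..<rank F (Suc i)} (d i) ?w r = v r" for r
  proof (cases "r < rank F i")
    case True
    have "mat_vec {..<rank F (Suc i)} (d i) ?w r = (\<Sum>s<rank F (Suc i). hom_component (\<delta> - gdeg F i r) (d i r s * w s))"
      unfolding mat_vec_def
    proof (intro sum.cong refl)
      fix s assume "s \<in> {..<rank F (Suc i)}"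
      then have "homogeneous (gdeg F (Suc i) s - gdeg F i r) (d i r s)" by (simp add: homogeneous_d)
      from hom_component_mult[OF this, of "\<delta> - gdeg F i r" "w s"]
      show "d i r s * ?w s = hom_component (\<delta> - gdeg F i r) (d i r s * w s)" by simp
    qed
    also have "\<dots> = hom_component (\<delta> - gdeg F i r) (v r)"
      unfolding w(2)[symmetric] mat_vec_def hom_component_sum ..
    also have "\<dots> = v r" using assms(2)[OF True] hom_component_homogeneous by metis
    finally show ?thesis .
  next
    case False
    then have "v r = 0" "\<And>s. d i r s = 0" unfolding w(2)[symmetric] by (auto simp: mat_vec_def diff_matrix_def)
    then show ?thesis by (simp add: mat_vec_def)
  qed
  ultimately show ?thesis using homogeneous_hom_component by (intro bexI[of _ ?w]) auto
qed

text \<open>A chain endomorphism that is the identity in degree 0 is homotopic to the identity, so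
  \<open>\<chi> - id = d k + k d\<close>. By minimality the entries of \<open>d\<close> have
  constant term 0, hence so do both products.\<close>

lemma self_map_unit:
  assumes \<chi>: "\<And>i s. s < rank F i \<Longrightarrow> (\<lambda>r. \<chi> i r s) \<in> free_module V F i"
    and \<chi>0: "\<chi> 0 0 0 = 1"
    and comm: "\<And>i s r. s < rank F (Suc i) \<Longrightarrow>
      mat_vec {..<rank F (Suc i)} (d i) (\<lambda>r. \<chi> (Suc i) r s) r = mat_vec {..<rank F i} (\<chi> i) (\<lambda>r. d i r s) r"
    and s: "s < rank F i"
  shows "coeff (\<chi> i s s) 0 = 1"
proof -
  \<comment> \<open>\<open>P\<close> reads \<open>d k d = (\<chi> - id) d\<close>, which makes the
    columns of \<open>\<chi> - id - k d\<close> cycles. \<open>Q\<close> is the homotopy formula one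
    degree higher, with \<open>k'\<close> a lift of these cycles. The start is \<open>k = 0\<close>,
    as \<open>\<chi>\<close> is the identity in degree 0.\<close>
  define P where "P i k \<longleftrightarrow> (\<forall>s<rank F i. (\<lambda>r. k r s) \<in> free_module V F (Suc i)) \<and>
    (\<forall>s<rank F (Suc i). \<forall>r. mat_vec {..<rank F (Suc i)} (d i) (mat_vec {..<rank F i} k (\<lambda>r. d i r s)) r =
      mat_vec {..<rank F i} (\<chi> i) (\<lambda>r. d i r s) r - d i r s)" for i k
  define Q where "Q i k k' \<longleftrightarrow> (\<forall>s<rank F (Suc i). \<forall>r. mat_vec {..<rank F (Suc (Suc i))} (d (Suc i)) (\<lambda>r. k' r s) r =
      \<chi> (Suc i) r s - (if r = s then 1 else 0) - mat_vec {..<rank F i} k (\<lambda>r. d i r s) r)" for i k k'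
  have "\<exists>k. \<forall>i. P i (k i) \<and> Q i (k i) (k (Suc i))"
  proof (rule dependent_nat_choice)
    have "mat_vec {..<rank F 0} (\<chi> 0) (\<lambda>r. d 0 r s) r = d 0 r s" if "s < rank F (Suc 0)" for s r
    proof (cases "r = 0")
      case False
      then show ?thesis
        using \<chi>[of 0 0] column[OF that] rank_0 by (simp add: mat_vec_def free_module_def)
    qed (use rank_0 \<chi>0 in \<open>simp add: mat_vec_def\<close>)
    then show "\<exists>k. P 0 k"
      unfolding P_def by (intro exI[of _ "\<lambda>r s. 0"]) (simp add: free_module_def mat_vec_def)
  next
    fix k i assume k: "P i k"
    define v where "v r s = \<chi> (Suc i) r s - (if r = s then 1 else 0) - mat_vec {..<rank F i} k (\<lambda>r. d i r s) r" for r s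
    have "(\<lambda>r. v r s) \<in> boundaries V F (Suc i)" if s: "s < rank F (Suc i)" for s
      unfolding boundaries_Suc
    proof
      show "(\<lambda>r. v r s) \<in> free_module V F (Suc i)"
        unfolding v_def using k
        by (intro free_module_diff free_module_mat_vec \<chi> s free_module_delta free_module_poly_ring[OF column])
          (auto simp: P_def)
      have "mat_vec {..<rank F (Suc i)} (d i) (\<lambda>r. if r = s then 1 else 0) r = d i r s" for r
        by (subst mat_vec_delta) (use s in auto)
      then show "\<forall>r. mat_vec {..<rank F (Suc i)} (d i) (\<lambda>r. v r s) r = 0"
        unfolding v_def mat_vec_diff using k s comm[OF s] by (simp add: P_def)
    qed
    then have "\<forall>s. \<exists>w. s < rank F (Suc i) \<longrightarrow> w \<in> free_module V F (Suc (Suc i)) \<and>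
        mat_vec {..<rank F (Suc (Suc i))} (d (Suc i)) w = (\<lambda>r. v r s)"
      by (metis boundariesE)
    then obtain k' where k': "\<And>s. s < rank F (Suc i) \<Longrightarrow> k' s \<in> free_module V F (Suc (Suc i))"
      "\<And>s. s < rank F (Suc i) \<Longrightarrow> mat_vec {..<rank F (Suc (Suc i))} (d (Suc i)) (k' s) = (\<lambda>r. v r s)"
      by metis
    have "P (Suc i) (\<lambda>r s. k' s r)"
      unfolding P_def
    proof (intro conjI allI impI)
      fix s r assume s: "s < rank F (Suc (Suc i))"
      have "mat_vec {..<rank F (Suc (Suc i))} (d (Suc i)) (mat_vec {..<rank F (Suc i)} (\<lambda>r s. k' s r) (\<lambda>r. d (Suc i) r s)) r
        = mat_vec {..<rank F (Suc i)} v (\<lambda>r. d (Suc i) r s) r"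
        unfolding mat_vec_mat_vec by (rule mat_vec_cong) (simp add: k'(2))
      also have "\<dots> = mat_vec {..<rank F (Suc i)} (\<chi> (Suc i)) (\<lambda>r. d (Suc i) r s) r
        - mat_vec {..<rank F (Suc i)} (\<lambda>r s. if r = s then 1 else 0) (\<lambda>r. d (Suc i) r s) r
        - mat_vec {..<rank F i} k (mat_vec {..<rank F (Suc i)} (d i) (\<lambda>r. d (Suc i) r s)) r"
        unfolding mat_vec_mat_vec by (simp add: v_def mat_vec_def left_diff_distrib sum_subtractf)
      also have "mat_vec {..<rank F i} k (mat_vec {..<rank F (Suc i)} (d i) (\<lambda>r. d (Suc i) r s)) r = 0"
        by (rule mat_vec_rows_zero) (simp add: d_d[OF s])
      also have "mat_vec {..<rank F (Suc i)} (\<lambda>r s. if r = s then 1 else 0) (\<lambda>r. d (Suc i) r s) r = d (Suc i) r s"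
        using free_module_0[OF column[OF s], of r] by (auto simp: mat_vec_def if_distrib[of "\<lambda>x. x * _"] sum.delta cong: if_cong)
      finally show "mat_vec {..<rank F (Suc (Suc i))} (d (Suc i)) (mat_vec {..<rank F (Suc i)} (\<lambda>r s. k' s r) (\<lambda>r. d (Suc i) r s)) r
        = mat_vec {..<rank F (Suc i)} (\<chi> (Suc i)) (\<lambda>r. d (Suc i) r s) r - d (Suc i) r s" by simp
    qed (use k'(1) in simp)
    moreover have "Q i k (\<lambda>r s. k' s r)"
      unfolding Q_def using k'(2) by (simp add: v_def fun_eq_iff)
    ultimately show "\<exists>k'. P (Suc i) k' \<and> Q i k k'" by blast
  qed
  then obtain k where k: "\<And>i. Q i (k i) (k (Suc i))" by blast
  show ?thesis
  proof (cases i)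
    case 0
    then show ?thesis using s rank_0 \<chi>0 by simp
  next
    case (Suc j)
    have "mat_vec {..<rank F (Suc i)} (d i) (\<lambda>r. k i r s) s = \<chi> i s s - 1 - mat_vec {..<rank F j} (k j) (\<lambda>r. d j r s) s"
      using k[of j] s Suc unfolding Q_def by simp
    then have "\<chi> i s s = 1 + mat_vec {..<rank F j} (k j) (\<lambda>r. d j r s) s + mat_vec {..<rank F (Suc i)} (d i) (\<lambda>r. k i r s) s"
      by (simp add: algebra_simps)
    moreover have "coeff (mat_vec {..<rank F j} (k j) (\<lambda>r. d j r s) s) 0 = 0"
      using s Suc by (simp add: mat_vec_def lookup_sum' coeff_mult_0 coeff_d_0)
    moreover have "coeff (mat_vec {..<rank F (Suc i)} (d i) (\<lambda>r. k i r s) s) 0 = 0"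
      by (simp add: mat_vec_def lookup_sum' coeff_mult_0 coeff_d_0)
    ultimately show ?thesis by (simp add: lookup_add)
  qed
qed

end

text \<open>The comparison theorem for resolutions, with control of degrees: each column is lifted
  by \<open>homogeneous_lift\<close>.\<close>

lemma chain_map:
  assumes "minimal_graded_free_resolution V I F" "minimal_graded_free_resolution V I P"
  shows "\<exists>\<phi>. (\<forall>i s. s < rank F i \<longrightarrow> (\<lambda>r. \<phi> i r s) \<in> free_module V P i \<and>
      (\<forall>r<rank P i. homogeneous (gdeg F i s - gdeg P i r) (\<phi> i r s))) \<and> \<phi> 0 0 0 = 1 \<and>
    (\<forall>i s. s < rank F (Suc i) \<longrightarrow> mat_vec {..<rank P (Suc i)} (diff_matrix P i) (\<lambda>r. \<phi> (Suc i) r s) =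
      mat_vec {..<rank F i} (\<phi> i) (\<lambda>r. diff_matrix F i r s))"
proof -
  interpret F: resolution V I F by unfold_locales (rule assms(1))
  interpret P: resolution V I P by unfold_locales (rule assms(2))
  \<comment> \<open>The last clause carries the induction: composed with the differential of
    \<open>F\<close> the map lands in the boundaries of \<open>P\<close>, so the next columns can be
    lifted. In degree 0 this holds because both image ideals are \<open>I\<close>.\<close>
  define A where "A i \<phi> \<longleftrightarrow> (\<forall>s. s < rank F i \<longrightarrow> (\<lambda>r. \<phi> r s) \<in> free_module V P i \<and>
      (\<forall>r<rank P i. homogeneous (gdeg F i s - gdeg P i r) (\<phi> r s))) \<and> (i = 0 \<longrightarrow> \<phi> 0 0 = 1) \<and>
      (\<forall>s<rank F (Suc i). mat_vec {..<rank F i} \<phi> (\<lambda>r. F.d i r s) \<in> boundaries V P i)" for i \<phi>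
  define C where "C i \<phi> \<phi>' \<longleftrightarrow> (\<forall>s<rank F (Suc i). mat_vec {..<rank P (Suc i)} (P.d i) (\<lambda>r. \<phi>' r s) =
      mat_vec {..<rank F i} \<phi> (\<lambda>r. F.d i r s))" for i \<phi> \<phi>'
  have "\<exists>\<phi>. \<forall>i. A i (\<phi> i) \<and> C i (\<phi> i) (\<phi> (Suc i))"
  proof (rule dependent_nat_choice)
    let ?\<phi> = "\<lambda>r s :: nat. if r = 0 then 1 else (0 :: ('a, 'b) mpoly)"
    have col: "(\<lambda>r. ?\<phi> r s) \<in> free_module V P 0" for s using P.rank_0 by (auto simp: free_module_def)
    have "mat_vec {..<rank F 0} ?\<phi> (\<lambda>r. F.d 0 r s) \<in> boundaries V P 0" if "s < rank F (Suc 0)" for s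
    proof -
      have "F.d 0 0 s \<in> I" using F.column_boundary[OF that] F.boundaries_0[OF F.column[OF that]] by simp
      then have "mat_vec {..<rank F 0} ?\<phi> (\<lambda>r. F.d 0 r s) 0 \<in> I" using F.rank_0 by (simp add: mat_vec_def)
      then show ?thesis
        using col free_module_poly_ring[OF F.column[OF that]] by (subst P.boundaries_0) (auto intro: free_module_mat_vec)
    qed
    then show "\<exists>\<phi>. A 0 \<phi>"
      unfolding A_def using col F.rank_0 P.rank_0
      by (intro exI[of _ ?\<phi>]) (auto simp: homogeneous_def mon_degree_def)
  next
    fix \<phi> i assume \<phi>: "A i \<phi>"
    have "\<exists>w\<in>free_module V P (Suc i). mat_vec {..<rank P (Suc i)} (P.d i) w = mat_vec {..<rank F i} \<phi> (\<lambda>r. F.d i r s) \<and>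
      (\<forall>r. homogeneous (gdeg F (Suc i) s - gdeg P (Suc i) r) (w r))" if s: "s < rank F (Suc i)" for s
    proof (rule P.homogeneous_lift)
      show "mat_vec {..<rank F i} \<phi> (\<lambda>r. F.d i r s) \<in> boundaries V P i" using \<phi> s by (simp add: A_def)
      show "homogeneous (gdeg F (Suc i) s - gdeg P i r) (mat_vec {..<rank F i} \<phi> (\<lambda>r. F.d i r s) r)"
        if r: "r < rank P i" for r
        unfolding mat_vec_def
      proof (rule homogeneous_sum)
        fix t assume "t \<in> {..<rank F i}"
        then have "homogeneous ((gdeg F i t - gdeg P i r) + (gdeg F (Suc i) s - gdeg F i t)) (\<phi> r t * F.d i t s)"
          using \<phi> r s by (intro homogeneous_mult F.homogeneous_d) (auto simp: A_def)
        then show "homogeneous (gdeg F (Suc i) s - gdeg P i r) (\<phi> r t * F.d i t s)" by simp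
      qed
    qed
    then obtain w where w: "\<And>s. s < rank F (Suc i) \<Longrightarrow> w s \<in> free_module V P (Suc i) \<and>
      mat_vec {..<rank P (Suc i)} (P.d i) (w s) = mat_vec {..<rank F i} \<phi> (\<lambda>r. F.d i r s) \<and>
      (\<forall>r. homogeneous (gdeg F (Suc i) s - gdeg P (Suc i) r) (w s r))" by metis
    let ?\<phi> = "\<lambda>r s. w s r"
    have "mat_vec {..<rank F (Suc i)} ?\<phi> (\<lambda>r. F.d (Suc i) r s) \<in> boundaries V P (Suc i)"
      if s: "s < rank F (Suc (Suc i))" for s
      unfolding P.boundaries_Suc
    proof (intro conjI allI)
      show "mat_vec {..<rank F (Suc i)} ?\<phi> (\<lambda>r. F.d (Suc i) r s) \<in> free_module V P (Suc i)"
        using w by (intro free_module_mat_vec free_module_poly_ring[OF F.column[OF s]]) auto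
      fix r
      have "mat_vec {..<rank P (Suc i)} (P.d i) (mat_vec {..<rank F (Suc i)} ?\<phi> (\<lambda>r. F.d (Suc i) r s)) r =
        mat_vec {..<rank F i} \<phi> (mat_vec {..<rank F (Suc i)} (F.d i) (\<lambda>r. F.d (Suc i) r s)) r"
        unfolding mat_vec_mat_vec by (rule mat_vec_cong) (use w in simp)
      also have "\<dots> = 0" by (rule mat_vec_rows_zero) (simp add: F.d_d[OF s])
      finally show "mat_vec {..<rank P (Suc i)} (P.d i) (mat_vec {..<rank F (Suc i)} ?\<phi> (\<lambda>r. F.d (Suc i) r s)) r = 0" .
    qed
    then have "A (Suc i) ?\<phi>" "C i \<phi> ?\<phi>" using w by (auto simp: A_def C_def)
    then show "\<exists>\<phi>'. A (Suc i) \<phi>' \<and> C i \<phi> \<phi>'" by blast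
  qed
  then obtain \<phi> where \<phi>: "\<And>i. A i (\<phi> i)" "\<And>i. C i (\<phi> i) (\<phi> (Suc i))" by blast
  have "\<phi> 0 0 0 = 1" using \<phi>(1)[of 0] by (simp add: A_def)
  then show ?thesis using \<phi> by (intro exI[of _ \<phi>]) (auto simp: A_def C_def)
qed

text \<open>The composite of the comparison maps in both directions has constant term 1 on the
  diagonal, so some \<open>\<phi> i r s\<close> has a nonzero constant term. Being homogeneous it
  has degree 0, and the two degrees agree. Multiplicities are not compared, as regularity only asks
  which degrees occur.\<close>

lemma minimal_resolution_degrees:
  assumes F: "minimal_graded_free_resolution V I F" and P: "minimal_graded_free_resolution V I P"
    and s: "s < rank F i"
  shows "\<exists>r<rank P i. gdeg P i r = gdeg F i s"
proof -
  interpret F: resolution V I F by unfold_locales (rule F)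
  obtain \<phi> where \<phi>: "\<And>i s. s < rank F i \<Longrightarrow> (\<lambda>r. \<phi> i r s) \<in> free_module V P i"
    "\<And>i s r. s < rank F i \<Longrightarrow> r < rank P i \<Longrightarrow> homogeneous (gdeg F i s - gdeg P i r) (\<phi> i r s)" "\<phi> 0 0 0 = 1"
    "\<And>i s. s < rank F (Suc i) \<Longrightarrow> mat_vec {..<rank P (Suc i)} (diff_matrix P i) (\<lambda>r. \<phi> (Suc i) r s) =
      mat_vec {..<rank F i} (\<phi> i) (\<lambda>r. diff_matrix F i r s)"
    using chain_map[OF F P] by metis
  obtain \<psi> where \<psi>: "\<And>i s. s < rank P i \<Longrightarrow> (\<lambda>r. \<psi> i r s) \<in> free_module V F i" "\<psi> 0 0 0 = 1"
    "\<And>i s. s < rank P (Suc i) \<Longrightarrow> mat_vec {..<rank F (Suc i)} (diff_matrix F i) (\<lambda>r. \<psi> (Suc i) r s) =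
      mat_vec {..<rank P i} (\<psi> i) (\<lambda>r. diff_matrix P i r s)"
    using chain_map[OF P F] by metis
  define \<chi> where "\<chi> i r s = mat_vec {..<rank P i} (\<psi> i) (\<lambda>r. \<phi> i r s) r" for i r s
  have "coeff (\<chi> i s s) 0 = 1"
  proof (rule F.self_map_unit[where \<chi> = \<chi>, OF _ _ _ s])
    show "(\<lambda>r. \<chi> i r s) \<in> free_module V F i" if "s < rank F i" for i s
      unfolding \<chi>_def by (rule free_module_mat_vec) (use \<phi>(1)[OF that] \<psi>(1) free_module_poly_ring in auto)
    show "\<chi> 0 0 0 = 1" using P \<phi>(3) \<psi>(2)
      by (simp add: \<chi>_def mat_vec_def minimal_graded_free_resolution_def)
    show "mat_vec {..<rank F (Suc i)} (F.d i) (\<lambda>r. \<chi> (Suc i) r s) r = mat_vec {..<rank F i} (\<chi> i) (\<lambda>r. F.d i r s) r"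
      if "s < rank F (Suc i)" for i s r
    proof -
      have "mat_vec {..<rank F (Suc i)} (F.d i) (\<lambda>r. \<chi> (Suc i) r s) r =
        mat_vec {..<rank P i} (\<psi> i) (mat_vec {..<rank P (Suc i)} (diff_matrix P i) (\<lambda>r. \<phi> (Suc i) r s)) r"
        unfolding \<chi>_def mat_vec_mat_vec by (rule mat_vec_cong) (simp add: \<psi>(3))
      also have "\<dots> = mat_vec {..<rank F i} (\<chi> i) (\<lambda>r. F.d i r s) r"
        unfolding \<phi>(4)[OF that] \<chi>_def mat_vec_mat_vec ..
      finally show ?thesis .
    qed
  qed
  then have "(\<Sum>r<rank P i. coeff (\<psi> i s r) 0 * coeff (\<phi> i r s) 0) \<noteq> 0"
    by (simp add: \<chi>_def mat_vec_def lookup_sum' coeff_mult_0)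
  then obtain r where r: "r < rank P i" "coeff (\<phi> i r s) 0 \<noteq> 0"
    by (metis (no_types, lifting) lessThan_iff mult_zero_right sum.neutral)
  then have "0 = gdeg F i s - gdeg P i r"
    using \<phi>(2)[OF s r(1)] by (force simp: homogeneous_def in_keys_iff mon_degree_def)
  then show ?thesis using r(1) by auto
qed

section \<open>From labelled complexes to resolutions\<close>

definition squarefree_mon :: "'v set \<Rightarrow> 'v \<Rightarrow>\<^sub>0 nat" where
  "squarefree_mon A = (\<Sum>v\<in>A. Poly_Mapping.single v 1)"

lemma lookup_squarefree_mon:
  "finite A \<Longrightarrow> Poly_Mapping.lookup (squarefree_mon A) v = (if v \<in> A then 1 else 0)"
  by (simp add: squarefree_mon_def lookup_sum' lookup_single when_def sum.delta cong: if_cong)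

lemma keys_squarefree_mon: "finite A \<Longrightarrow> Poly_Mapping.keys (squarefree_mon A) = A"
  by (auto simp: in_keys_iff lookup_squarefree_mon split: if_splits)

lemma mon_degree_squarefree_mon: "finite A \<Longrightarrow> mon_degree (squarefree_mon A) = card A"
  by (simp add: mon_degree_def keys_squarefree_mon lookup_squarefree_mon)

lemma squarefree_mon_add_minus:
  "finite A \<Longrightarrow> A \<subseteq> Poly_Mapping.keys t \<Longrightarrow> squarefree_mon A + (t - squarefree_mon A) = t"
  by (rule poly_mapping_eqI) (force simp: lookup_add lookup_minus lookup_squarefree_mon in_keys_iff)

lemma squarefree_mon_minus_inject:
  "finite A \<Longrightarrow> A \<subseteq> Poly_Mapping.keys s \<Longrightarrow> A \<subseteq> Poly_Mapping.keys t \<Longrightarrow>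
    s - squarefree_mon A = t - squarefree_mon A \<longleftrightarrow> s = t"
  by (metis squarefree_mon_add_minus)

lemma squarefree_mon_insert:
  "finite A \<Longrightarrow> v \<notin> A \<Longrightarrow> squarefree_mon (insert v A) = squarefree_mon A + Poly_Mapping.single v 1"
  by (simp add: squarefree_mon_def add.commute)

lemma var_mult_var: "u \<noteq> v \<Longrightarrow> var u * var v = monomial (squarefree_mon {u, v}) 1"
  by (simp add: var_def mult_single squarefree_mon_def)

definition support_ideal :: "'v set \<Rightarrow> ('v set \<Rightarrow> bool) \<Rightarrow> ('v, 'k::field) mpoly set" where
  "support_ideal V I = {p \<in> poly_ring V. \<forall>t\<in>Poly_Mapping.keys p. I (Poly_Mapping.keys t)}"

lemma support_ideal_sum:
  "(\<And>x. x \<in> A \<Longrightarrow> f x \<in> support_ideal V I) \<Longrightarrow> sum f A \<in> support_ideal V I"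
proof (induction A rule: infinite_finite_induct)
  case (insert x A)
  then have "f x \<in> support_ideal V I" "sum f A \<in> support_ideal V I" by auto
  then have "f x + sum f A \<in> support_ideal V I"
    using Poly_Mapping.keys_add[of "f x" "sum f A"] by (auto simp: support_ideal_def intro: poly_ring_add)
  then show ?case using insert by simp
qed (auto simp: support_ideal_def)

text \<open>Membership in a monomial ideal is decided monomial by monomial, and a monomial is
  divisible by the generator of an edge iff its support contains the edge.\<close>

lemma edge_ideal_eq:
  assumes "\<And>e. e \<in> edges G \<Longrightarrow> \<exists>u v. e = {u, v} \<and> u \<noteq> v \<and> u \<in> verts G \<and> v \<in> verts G"
  shows "(edge_ideal G :: ('v, 'k::field) mpoly set) = support_ideal (verts G) (edge_family (edges G))"
    (is "?L = ?R")
proof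
  let ?gens = "{var u * var v | u v. {u, v} \<in> edges G} :: ('v, 'k) mpoly set"
  have gen: "\<exists>e\<in>edges G. s = monomial (squarefree_mon e) 1 \<and> finite e \<and> e \<subseteq> verts G" if s: "s \<in> ?gens" for s
  proof -
    obtain u v where uv: "s = var u * var v" "{u, v} \<in> edges G" using s by blast
    have "u \<noteq> v" "u \<in> verts G" "v \<in> verts G" using assms[OF uv(2)] by (auto simp: doubleton_eq_iff)
    then show ?thesis using uv var_mult_var by (intro bexI[of _ "{u, v}"]) auto
  qed
  show "?L \<subseteq> ?R"
  proof
    fix p assume "p \<in> ?L"
    then obtain T c where T: "p = (\<Sum>s\<in>T. c s * s)" "T \<subseteq> ?gens" "\<forall>s\<in>T. c s \<in> poly_ring (verts G)"
      unfolding edge_ideal_def ideal_generated_def by auto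
    have "c s * s \<in> ?R" if s: "s \<in> T" for s
    proof -
      obtain e where e: "e \<in> edges G" "s = monomial (squarefree_mon e) 1" "finite e" "e \<subseteq> verts G"
        using gen s T(2) by (metis (no_types, lifting) subsetD)
      have "s \<in> poly_ring (verts G)" using e by (simp add: poly_ring_def keys_squarefree_mon)
      moreover have "edge_family (edges G) (Poly_Mapping.keys t)" if "t \<in> Poly_Mapping.keys (c s * s)" for t
        using that keys_mult[of "c s" s] e
        by (fastforce simp: keys_add_nat keys_squarefree_mon edge_family_def)
      ultimately show ?thesis using T s by (auto simp: support_ideal_def intro: poly_ring_mult)
    qed
    then show "p \<in> ?R" unfolding T(1) by (rule support_ideal_sum)
  qed
  show "?R \<subseteq> ?L"
  proof
    fix p :: "('v, 'k) mpoly" assume p: "p \<in> ?R"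
    have "\<exists>e. e \<in> edges G \<and> e \<subseteq> Poly_Mapping.keys t" if "t \<in> Poly_Mapping.keys p" for t
      using p that unfolding support_ideal_def edge_family_def by blast
    then obtain e where e: "\<And>t. t \<in> Poly_Mapping.keys p \<Longrightarrow> e t \<in> edges G \<and> e t \<subseteq> Poly_Mapping.keys t"
      by metis
    define g :: "('v \<Rightarrow>\<^sub>0 nat) \<Rightarrow> ('v, 'k) mpoly" where "g t = monomial (squarefree_mon (e t)) 1" for t
    define q :: "('v \<Rightarrow>\<^sub>0 nat) \<Rightarrow> ('v, 'k) mpoly" where "q t = monomial (t - squarefree_mon (e t)) (coeff p t)" for t
    have fin: "finite (e t)" if "t \<in> Poly_Mapping.keys p" for t
      using e[OF that] by (meson finite_keys finite_subset)
    have gg: "g t \<in> ?gens" if t: "t \<in> Poly_Mapping.keys p" for t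
    proof -
      obtain u v where "e t = {u, v}" "u \<noteq> v" using assms e[OF t] by metis
      then have "g t = var u * var v" "{u, v} \<in> edges G" using e[OF t] by (simp_all add: g_def var_mult_var)
      then show ?thesis by blast
    qed
    have qg: "q t * g t = monomial t (coeff p t)" if t: "t \<in> Poly_Mapping.keys p" for t
      using squarefree_mon_add_minus[OF fin[OF t], of t] e[OF t]
      by (simp add: q_def g_def mult_single add.commute)
    have q: "q t \<in> poly_ring (verts G)" if t: "t \<in> Poly_Mapping.keys p" for t
    proof -
      have "Poly_Mapping.keys (t - squarefree_mon (e t)) \<subseteq> Poly_Mapping.keys t"
        by (auto simp: in_keys_iff lookup_minus)
      then show ?thesis using p t by (auto simp: q_def poly_ring_def support_ideal_def split: if_splits)
    qed
    have "p = (\<Sum>t\<in>Poly_Mapping.keys p. q t * g t)"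
      using sum_monomials[of p] qg by (simp cong: sum.cong)
    \<comment> \<open>\<open>ideal_generated\<close> allows one coefficient per generator, so the
      monomials for which the same generator was chosen are collected.\<close>
    also have "\<dots> = (\<Sum>s\<in>g ` Poly_Mapping.keys p. \<Sum>t\<in>{t \<in> Poly_Mapping.keys p. g t = s}. q t * g t)"
      by (rule sum.image_gen) simp
    also have "\<dots> = (\<Sum>s\<in>g ` Poly_Mapping.keys p. (\<Sum>t\<in>{t \<in> Poly_Mapping.keys p. g t = s}. q t) * s)"
      unfolding sum_distrib_right by (intro sum.cong refl) auto
    finally show "p \<in> ?L"
      unfolding edge_ideal_def ideal_generated_def mem_Collect_eq
      using gg q by (intro exI[of _ "g ` Poly_Mapping.keys p"]
          exI[of _ "\<lambda>s. \<Sum>t\<in>{t \<in> Poly_Mapping.keys p. g t = s}. q t"] conjI ballI poly_ring_sum) auto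
  qed
qed

section \<open>The free resolution encoded by a labelled complex\<close>

locale finite_labels = labelled_complex B h S c e0 I
  for B :: "'b set" and h and S :: "'b \<Rightarrow> 'v set" and c :: "'b \<Rightarrow> 'b \<Rightarrow> 'k::field" and e0 I +
  fixes V :: "'v set"
  assumes finite_V: "finite V" and labels: "x \<in> B \<Longrightarrow> S x \<subseteq> V"
begin

lemma finite_label: "x \<in> B \<Longrightarrow> finite (S x)"
  using labels finite_V by (rule finite_subset)

definition mat :: "'b \<Rightarrow> 'b \<Rightarrow> ('v, 'k) mpoly" where
  "mat x y = monomial (squarefree_mon (S y - S x)) (c x y)"

lemma mat_eq_0 [simp]: "mat x y = 0 \<longleftrightarrow> c x y = 0"
  by (auto simp: mat_def) (metis lookup_single_eq lookup_zero)

text \<open>The part of \<open>f\<close> in multidegree \<open>t\<close>. The basis element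
  \<open>x\<close> has the multidegree of its label, so its coefficient there is that of
  \<open>t\<close> divided by the label monomial, and \<open>x\<close> is present only if this
  division is possible.\<close>

definition strand :: "('b \<Rightarrow> ('v, 'k) mpoly) \<Rightarrow> ('v \<Rightarrow>\<^sub>0 nat) \<Rightarrow> 'b \<Rightarrow> 'k" where
  "strand f t x = (if x \<in> B \<and> S x \<subseteq> Poly_Mapping.keys t then coeff (f x) (t - squarefree_mon (S x)) else 0)"

text \<open>The monomials in \<open>mat\<close> account exactly for the differences between the
  labels, so multidegrees are preserved and on each strand only the scalars \<open>c\<close>
  remain.\<close>

lemma strand_mat: "strand (mat_vec B mat f) t x = mat_vec B c (strand f t) x"
proof (cases "x \<in> B \<and> S x \<subseteq> Poly_Mapping.keys t")
  case True
  have *: "coeff (mat x y * f y) (t - squarefree_mon (S x)) = c x y * strand f t y" if y: "y \<in> B" for y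
  proof (cases "c x y = 0")
    case True
    then show ?thesis by (simp add: mat_def)
  next
    case False
    then have sub: "S x \<subseteq> S y" using c_nonzero by blast
    note fin = finite_label[OF y] finite_label[OF conjunct1[OF True]]
    show ?thesis
    proof (cases "S y \<subseteq> Poly_Mapping.keys t")
      case ySub: True
      have "t - squarefree_mon (S x) = squarefree_mon (S y - S x) + (t - squarefree_mon (S y))"
        using ySub sub fin
        by (intro poly_mapping_eqI) (force simp: lookup_add lookup_minus lookup_squarefree_mon in_keys_iff)
      then show ?thesis using y ySub by (simp add: mat_def coeff_monomial_mult strand_def)
    next
      case False
      \<comment> \<open>At this \<open>v\<close>, which lies in \<open>S y - S x\<close>, the
        exponent of \<open>t\<close> is 0. So the monomial looked up is not a multiple of the one in
        \<open>mat x y\<close>.\<close>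
      then obtain v where v: "v \<in> S y" "v \<notin> Poly_Mapping.keys t" by blast
      then have "v \<notin> S x" using True by blast
      have "t - squarefree_mon (S x) \<noteq> squarefree_mon (S y - S x) + u" for u
      proof
        assume "t - squarefree_mon (S x) = squarefree_mon (S y - S x) + u"
        from arg_cong[OF this, of "\<lambda>w. Poly_Mapping.lookup w v"] show False
          using v fin \<open>v \<notin> S x\<close> by (simp add: lookup_add lookup_minus lookup_squarefree_mon in_keys_iff)
      qed
      then show ?thesis using False by (simp add: mat_def coeff_monomial_mult_eq_0 strand_def)
    qed
  qed
  then show ?thesis using True by (simp add: strand_def[of "mat_vec B mat f"] mat_vec_def lookup_sum' * cong: sum.cong)
next
  case False
  have "mat_vec B c (strand f t) x = 0"
    by (rule mat_vec_rows_zero) (use False c_nonzero in \<open>force simp: strand_def split: if_splits\<close>)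
  then show ?thesis using False by (auto simp: strand_def)
qed

lemma coeff_eq_strand:
  assumes "x \<in> B"
  shows "coeff (f x) u = strand f (squarefree_mon (S x) + u) x"
  using assms finite_label[OF assms] by (simp add: strand_def keys_add_nat keys_squarefree_mon)

lemma mat_vec_mat_notin: "x \<notin> B \<Longrightarrow> mat_vec B mat f x = 0"
  by (rule mat_vec_rows_zero) (use c_nonzero in auto)

lemma mat_square_zero: "mat_vec B mat (mat_vec B mat f) x = 0"
proof (cases "x \<in> B")
  case True
  have "strand (mat_vec B mat f) t = mat_vec B c (strand f t)" for t by (rule ext) (rule strand_mat)
  then show ?thesis
    by (intro poly_mapping_eqI, subst coeff_eq_strand[OF True]) (simp add: strand_mat mat_vec_square_zero)
qed (simp add: mat_vec_mat_notin)

lemma mat_vec_mat_e0: "t \<in> Poly_Mapping.keys (mat_vec B mat f e0) \<Longrightarrow> I (Poly_Mapping.keys t)"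
proof -
  assume "t \<in> Poly_Mapping.keys (mat_vec B mat f e0)"
  then have "mat_vec B c (strand f (squarefree_mon (S e0) + t)) e0 \<noteq> 0"
    using coeff_eq_strand[OF e0_in, of "mat_vec B mat f" t] by (simp add: in_keys_iff strand_mat)
  then obtain y where "c e0 y \<noteq> 0" "strand f (squarefree_mon (S e0) + t) y \<noteq> 0" by (rule mat_vec_nonzero)
  then show ?thesis using augmentation by (auto simp: S_e0 squarefree_mon_def strand_def split: if_splits)
qed

text \<open>In multidegree \<open>t\<close> the cycle is lifted with \<open>U\<close> the support of
  \<open>t\<close>. Only finitely many multidegrees occur in \<open>f\<close>, so the scalar
  preimages add up to polynomials.\<close>

lemma mat_exact:
  assumes f: "\<And>x. f x \<noteq> 0 \<Longrightarrow> x \<in> B \<and> h x = i" "\<And>x. f x \<in> poly_ring V"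
    and f0: "\<And>t. t \<in> Poly_Mapping.keys (f e0) \<Longrightarrow> I (Poly_Mapping.keys t)"
    and cyc: "\<And>x. mat_vec B mat f x = 0"
  shows "\<exists>g. (\<forall>x. g x \<noteq> 0 \<longrightarrow> x \<in> B \<and> h x = Suc i) \<and> (\<forall>x. g x \<in> poly_ring V) \<and> (\<forall>x. mat_vec B mat g x = f x)"
proof -
  have strand_nz: "x \<in> B \<and> S x \<subseteq> Poly_Mapping.keys t \<and> h x = i" if "strand f t x \<noteq> 0" for t x
    using that f(1)[of x] by (cases "f x = 0") (auto simp: strand_def split: if_splits)
  have "\<exists>g. (\<forall>x. g x \<noteq> 0 \<longrightarrow> x \<in> B \<and> S x \<subseteq> Poly_Mapping.keys t \<and> h x = Suc i) \<and>
      (\<forall>x. mat_vec B c g x = strand f t x)" for t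
  proof (rule cycle_lift[OF strand_nz])
    show "I (Poly_Mapping.keys t)" if "strand f t e0 \<noteq> 0"
      using that f0[of t] by (simp add: strand_def S_e0 squarefree_mon_def in_keys_iff split: if_splits)
    show "mat_vec B c (strand f t) x = 0" for x
      unfolding strand_mat[symmetric] by (simp add: strand_def cyc)
  qed
  then obtain \<gamma> where \<gamma>: "\<And>t x. \<gamma> t x \<noteq> 0 \<Longrightarrow> x \<in> B \<and> S x \<subseteq> Poly_Mapping.keys t \<and> h x = Suc i"
    "\<And>t x. mat_vec B c (\<gamma> t) x = strand f t x" by metis
  \<comment> \<open>The multidegrees that occur in \<open>f\<close>. Outside \<open>T\<close> the
    strands of \<open>f\<close> vanish, and 0 is taken as preimage.\<close>
  define T where "T = (\<Union>x\<in>B. (\<lambda>u. squarefree_mon (S x) + u) ` Poly_Mapping.keys (f x))"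
  have finT: "finite T" using finite_B by (simp add: T_def)
  define g where "g y = (\<Sum>t\<in>{t \<in> T. y \<in> B \<and> S y \<subseteq> Poly_Mapping.keys t}. monomial (t - squarefree_mon (S y)) (\<gamma> t y))" for y
  have strand_T: "strand f t x = 0" if "t \<notin> T" for t x
  proof (rule ccontr)
    assume "strand f t x \<noteq> 0"
    then have x: "x \<in> B" "S x \<subseteq> Poly_Mapping.keys t" "t - squarefree_mon (S x) \<in> Poly_Mapping.keys (f x)"
      by (auto simp: strand_def in_keys_iff split: if_splits)
    then have "t = squarefree_mon (S x) + (t - squarefree_mon (S x))"
      using squarefree_mon_add_minus[OF finite_label] by metis
    then have "t \<in> T" using x unfolding T_def by blast
    then show False using that by simp
  qed
  have strand_g: "strand g t y = (if t \<in> T then \<gamma> t y else 0)" for t y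
  proof (cases "y \<in> B \<and> S y \<subseteq> Poly_Mapping.keys t")
    case True
    have "strand g t y = (\<Sum>s\<in>{s \<in> T. y \<in> B \<and> S y \<subseteq> Poly_Mapping.keys s}. if s = t then \<gamma> s y else 0)"
      unfolding strand_def g_def lookup_sum' using True squarefree_mon_minus_inject[OF finite_label]
      by (auto simp: lookup_single when_def intro!: sum.cong)
    also have "\<dots> = (if t \<in> T then \<gamma> t y else 0)"
      using finT True by (simp add: sum.delta)
    finally show ?thesis .
  next
    case False
    then show ?thesis using \<gamma>(1)[of t y] by (auto simp: strand_def)
  qed
  have strand_eq: "mat_vec B c (strand g t) x = strand f t x" for t x
  proof (cases "t \<in> T")
    case True
    then have "strand g t = \<gamma> t" using strand_g by auto
    then show ?thesis using \<gamma>(2) by simp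
  next
    case False
    then have "strand g t = (\<lambda>y. 0)" using strand_g by auto
    then show ?thesis using strand_T[OF False] by simp
  qed
  have "mat_vec B mat g x = f x" for x
  proof (cases "x \<in> B")
    case True
    have "coeff (mat_vec B mat g x) u = coeff (f x) u" for u
      unfolding coeff_eq_strand[OF True] strand_mat strand_eq ..
    then show ?thesis by (rule poly_mapping_eqI)
  next
    case False
    then show ?thesis using f(1)[of x] by (auto simp: mat_vec_mat_notin)
  qed
  moreover have "x \<in> B \<and> h x = Suc i" if "g x \<noteq> 0" for x
  proof -
    obtain t where "\<gamma> t x \<noteq> 0"
      using \<open>g x \<noteq> 0\<close> unfolding g_def by (metis (no_types, lifting) single_zero sum.neutral)
    then show ?thesis using \<gamma>(1) by blast
  qed
  moreover have "g x \<in> poly_ring V" for x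
    unfolding g_def
  proof (rule poly_ring_sum)
    fix t assume t: "t \<in> {t \<in> T. x \<in> B \<and> S x \<subseteq> Poly_Mapping.keys t}"
    then obtain y u where y: "y \<in> B" "u \<in> Poly_Mapping.keys (f y)" "t = squarefree_mon (S y) + u"
      by (auto simp: T_def)
    then have "Poly_Mapping.keys t \<subseteq> V"
      using f(2)[of y] labels[OF y(1)] by (auto simp: poly_ring_def keys_add_nat keys_squarefree_mon[OF finite_label])
    moreover have "Poly_Mapping.keys (t - squarefree_mon (S x)) \<subseteq> Poly_Mapping.keys t"
      by (auto simp: in_keys_iff lookup_minus)
    ultimately show "monomial (t - squarefree_mon (S x)) (\<gamma> t x) \<in> poly_ring V"
      by (auto simp: poly_ring_def split: if_splits)
  qed
  ultimately show ?thesis by blast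
qed

text \<open>The elements of each height are numbered. \<open>push\<close> and \<open>pull\<close>
  translate between vectors indexed by numbers below the rank and vectors on \<open>B\<close>
  concentrated in one height, where \<open>mat_exact\<close> applies.\<close>

lemma to_resolution:
  assumes min: "minimal_labels S c"
  shows "\<exists>F. minimal_graded_free_resolution V (support_ideal V I :: ('v, 'k) mpoly set) F \<and>
    (\<forall>i j. (\<exists>r<rank F i. gdeg F i r = j) \<longleftrightarrow> (\<exists>x\<in>B. h x = i \<and> int (card (S x)) = j))"
proof -
  define Bi where "Bi i = {x \<in> B. h x = i}" for i
  have "\<exists>f. bij_betw f {..<card (Bi i)} (Bi i)" for i
    using ex_bij_betw_nat_finite[of "Bi i"] finite_B by (auto simp: Bi_def lessThan_atLeast0)
  then obtain en where en: "\<And>i. bij_betw (en i) {..<card (Bi i)} (Bi i)" by metis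
  define F :: "('v, 'k) graded_free_seq" where "F = \<lparr>rank = \<lambda>i. card (Bi i),
    gdeg = \<lambda>i r. int (card (S (en i r))), entry = \<lambda>i r s. mat (en i r) (en (Suc i) s)\<rparr>"
  have F: "rank F i = card (Bi i)" "gdeg F i r = int (card (S (en i r)))"
    "entry F i r s = mat (en i r) (en (Suc i) s)" for i r s by (simp_all add: F_def)
  have en_in: "en i r \<in> B \<and> h (en i r) = i" if "r < rank F i" for i r
    using bij_betwE[OF en[of i]] that by (auto simp: F Bi_def)
  define ix where "ix i = inv_into {..<card (Bi i)} (en i)" for i
  have ix: "ix i x < rank F i" "en i (ix i x) = x" if "x \<in> B" "h x = i" for i x
    using that bij_betw_inv_into_right[OF en[of i], of x] bij_betwE[OF bij_betw_inv_into[OF en[of i]]]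
    by (auto simp: ix_def F Bi_def)
  have ix_en: "ix i (en i r) = r" if "r < rank F i" for i r
    using bij_betw_inv_into_left[OF en[of i], of r] that by (simp add: ix_def F)
  define push where "push i f x = (if x \<in> B \<and> h x = i then f (ix i x) else 0)"
    for i and f :: "nat \<Rightarrow> ('v, 'k) mpoly" and x
  define pull where "pull i g r = (if r < rank F i then g (en i r) else 0)"
    for i and g :: "'b \<Rightarrow> ('v, 'k) mpoly" and r
  have push_pull: "push i (pull i g) = g" if "\<And>x. g x \<noteq> 0 \<Longrightarrow> x \<in> B \<and> h x = i" for i g
    using that ix by (fastforce simp: push_def pull_def)
  have pull_push: "pull i (push i f) = f" if "f \<in> free_module V F i" for i f
    using that en_in ix_en by (fastforce simp: push_def pull_def free_module_def)
  have push_nz: "x \<in> B \<and> h x = i" if "push i f x \<noteq> 0" for i f x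
    using that by (auto simp: push_def split: if_splits)
  have push_ring: "push i f x \<in> poly_ring V" if "f \<in> free_module V F i" for i f x
    using free_module_poly_ring[OF that] by (simp add: push_def)
  have pull_free: "pull i g \<in> free_module V F i" if "\<And>x. g x \<in> poly_ring V" for i g
    using that by (simp add: pull_def free_module_def)
  have D_row: "differential F i f r = mat_vec B mat (push (Suc i) f) (en i r)" if r: "r < rank F i" for i f r
  proof -
    have "differential F i f r = (\<Sum>s<card (Bi (Suc i)). mat (en i r) (en (Suc i) s) * push (Suc i) f (en (Suc i) s))"
      unfolding differential_def using r en_in[of _ "Suc i"] ix_en[of _ "Suc i"]
      by (auto simp: push_def F intro!: sum.cong)
    also have "\<dots> = (\<Sum>y\<in>Bi (Suc i). mat (en i r) y * push (Suc i) f y)"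
      by (rule sum.reindex_bij_betw[OF en])
    also have "\<dots> = mat_vec B mat (push (Suc i) f) (en i r)"
      unfolding mat_vec_def using finite_B by (intro sum.mono_neutral_left) (auto simp: Bi_def push_def)
    finally show ?thesis .
  qed
  have push_D: "push i (differential F i f) x = mat_vec B mat (push (Suc i) f) x" for i f x
  proof (cases "x \<in> B \<and> h x = i")
    case True
    then show ?thesis using D_row[of "ix i x" i f] ix[of x i] by (simp add: push_def)
  next
    case False
    have "mat_vec B mat (push (Suc i) f) x = 0"
      by (rule mat_vec_rows_zero) (use False c_nonzero in \<open>force simp: push_def split: if_splits\<close>)
    then show ?thesis using False by (auto simp: push_def)
  qed
  have D_free: "differential F i f \<in> free_module V F i" if "f \<in> free_module V F (Suc i)" for i f
  proof (rule free_moduleI)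
    fix r assume "r < rank F i"
    have "mat x y \<in> poly_ring V" if "y \<in> B" for x y
      using labels[OF that] finite_label[OF that] by (auto simp: mat_def poly_ring_def keys_squarefree_mon split: if_splits)
    then show "differential F i f r \<in> poly_ring V"
      unfolding D_row[OF \<open>r < rank F i\<close>] using push_ring[OF that] by (intro poly_ring_mat_vec)
  qed (simp add: differential_def)
  have lift: "\<exists>g\<in>free_module V F (Suc i). differential F i g = f"
    if f: "f \<in> free_module V F i" and f0: "\<And>t. t \<in> Poly_Mapping.keys (push i f e0) \<Longrightarrow> I (Poly_Mapping.keys t)"
      and cyc: "\<And>x. mat_vec B mat (push i f) x = 0" for i f
  proof -
    obtain g where g: "\<And>x. g x \<noteq> 0 \<Longrightarrow> x \<in> B \<and> h x = Suc i" "\<And>x. g x \<in> poly_ring V"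
      "\<And>x. mat_vec B mat g x = push i f x"
      using mat_exact[of "push i f" i] push_nz push_ring[OF f] f0 cyc by metis
    have pp: "push (Suc i) (pull (Suc i) g) = g" by (rule push_pull) (rule g(1))
    have eq: "push i (differential F i (pull (Suc i) g)) = push i f"
      by (rule ext, subst push_D, subst pp, rule g(3))
    have pf: "pull (Suc i) g \<in> free_module V F (Suc i)" by (rule pull_free) (rule g(2))
    then have "differential F i (pull (Suc i) g) \<in> free_module V F i" by (rule D_free)
    from pull_push[OF this] have "differential F i (pull (Suc i) g) = f"
      unfolding eq pull_push[OF f] by (rule sym)
    then show ?thesis using pf by blast
  qed
  have B0: "Bi 0 = {e0}"
  proof (intro equalityI subsetI)
    show "x \<in> {e0}" if "x \<in> Bi 0" for x using that height_zero[of x] by (simp add: Bi_def)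
    show "x \<in> Bi 0" if "x \<in> {e0}" for x using that e0_in h_e0 by (simp add: Bi_def)
  qed
  have en0: "en 0 0 = e0" "rank F 0 = 1" using bij_betwE[OF en[of 0]] by (auto simp: B0 F)
  have ix0: "ix 0 e0 = 0" using ix_en[of 0 0] en0 by simp
  have "minimal_graded_free_resolution V (support_ideal V I) F"
    unfolding minimal_graded_free_resolution_def
  proof (intro conjI allI impI)
    show "rank F 0 = 1" "gdeg F 0 0 = 0" using en0 by (simp_all add: F S_e0)
  next
    fix i r s assume "r < rank F i \<and> s < rank F (Suc i)"
    then have B: "en i r \<in> B" "en (Suc i) s \<in> B" using en_in by auto
    let ?x = "en i r" and ?y = "en (Suc i) s"
    note fin = finite_label[OF B(1)] finite_label[OF B(2)]
    show "entry F i r s \<in> poly_ring V"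
      using labels[OF B(2)] fin by (auto simp: F mat_def poly_ring_def keys_squarefree_mon split: if_splits)
    show "homogeneous (gdeg F (Suc i) s - gdeg F i r) (entry F i r s)"
    proof (cases "c ?x ?y = 0")
      case False
      then have sub: "S ?x \<subseteq> S ?y" using c_nonzero by blast
      then have "card (S ?x) \<le> card (S ?y)" using fin by (intro card_mono)
      then show ?thesis using fin sub
        by (auto simp: homogeneous_def F mat_def mon_degree_squarefree_mon card_Diff_subset)
    qed (simp add: F mat_def)
    show "entry F i r s \<in> ideal_generated V (var ` V)"
    proof (cases "c ?x ?y = 0")
      case True
      then show ?thesis unfolding ideal_generated_def by (auto simp: F mat_def intro!: exI[of _ "{}"])
    next
      case False
      \<comment> \<open>The labels are nested and distinct, so a variable can be split off the
        entry.\<close>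
      then obtain v where v: "v \<in> S ?y - S ?x" using c_nonzero min by (force simp: minimal_labels_def)
      let ?A = "S ?y - S ?x - {v}"
      have "squarefree_mon (S ?y - S ?x) = squarefree_mon ?A + Poly_Mapping.single v 1"
        using squarefree_mon_insert[of ?A v] fin v by (simp add: insert_absorb)
      then have "entry F i r s = monomial (squarefree_mon ?A) (c ?x ?y) * var v"
        by (simp add: F mat_def var_def mult_single)
      moreover have "monomial (squarefree_mon ?A) (c ?x ?y) \<in> poly_ring V"
        using labels[OF B(2)] fin by (auto simp: poly_ring_def keys_squarefree_mon)
      ultimately show ?thesis unfolding ideal_generated_def using v labels[OF B(2)]
        by (auto intro!: exI[of _ "{var v}"] exI[of _ "\<lambda>_. monomial (squarefree_mon ?A) (c ?x ?y)"])
    qed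
  next
    show "(\<lambda>f. f 0) ` differential F 0 ` free_module V F 1 = support_ideal V I"
    proof (intro equalityI subsetI)
      fix p assume "p \<in> (\<lambda>f. f 0) ` differential F 0 ` free_module V F 1"
      then obtain f where f: "f \<in> free_module V F (Suc 0)" "p = differential F 0 f 0" by auto
      have "p = mat_vec B mat (push (Suc 0) f) e0" using D_row[of 0 0 f] en0 f by simp
      moreover have "p \<in> poly_ring V" using free_module_poly_ring[OF D_free[OF f(1)]] f(2) by simp
      ultimately show "p \<in> support_ideal V I"
        using mat_vec_mat_e0 by (simp add: support_ideal_def)
    next
      fix p :: "('v, 'k) mpoly" assume p: "p \<in> support_ideal V I"
      let ?f = "\<lambda>r :: nat. if r = 0 then p else 0"
      have "mat_vec B mat (push 0 ?f) x = 0" for x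
        by (rule mat_vec_rows_zero) (use c_nonzero in \<open>force simp: push_def split: if_splits\<close>)
      then have "\<exists>g\<in>free_module V F (Suc 0). differential F 0 g = ?f"
        using p en0 by (intro lift) (auto simp: push_def ix0 e0_in h_e0 support_ideal_def free_module_def)
      then obtain g where g: "g \<in> free_module V F 1" "differential F 0 g = ?f" by auto
      then have "p = differential F 0 g 0" by simp
      then show "p \<in> (\<lambda>f. f 0) ` differential F 0 ` free_module V F 1" using g(1) by blast
    qed
  next
    fix i
    show "differential F (Suc i) ` free_module V F (Suc (Suc i)) =
      {f \<in> free_module V F (Suc i). differential F i f = (\<lambda>r. 0)}"
    proof (intro equalityI subsetI)
      fix f assume "f \<in> differential F (Suc i) ` free_module V F (Suc (Suc i))"
      then obtain g where g: "g \<in> free_module V F (Suc (Suc i))" "f = differential F (Suc i) g" by blast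
      have "push (Suc i) f = mat_vec B mat (push (Suc (Suc i)) g)" unfolding g(2) by (rule ext) (rule push_D)
      then have "differential F i f r = 0" if "r < rank F i" for r
        unfolding D_row[OF that] by (simp add: mat_square_zero)
      then have "differential F i f r = 0" for r
        by (cases "r < rank F i") (auto simp: differential_def[of F i])
      then show "f \<in> {f \<in> free_module V F (Suc i). differential F i f = (\<lambda>r. 0)}"
        using D_free[OF g(1)] g(2) by auto
    next
      fix f assume "f \<in> {f \<in> free_module V F (Suc i). differential F i f = (\<lambda>r. 0)}"
      then have f: "f \<in> free_module V F (Suc i)" "differential F i f = (\<lambda>r. 0)" by auto
      have "mat_vec B mat (push (Suc i) f) x = 0" for x
        using push_D[of i f x] f(2) by (simp add: push_def)
      \<comment> \<open>In positive height the condition of \<open>lift\<close> at \<open>e0\<close>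
        is vacuous.\<close>
      then have "\<exists>g\<in>free_module V F (Suc (Suc i)). differential F (Suc i) g = f"
        using f(1) by (intro lift) (auto simp: push_def h_e0)
      then show "f \<in> differential F (Suc i) ` free_module V F (Suc (Suc i))" by auto
    qed
  qed
  moreover have "(\<exists>r<rank F i. gdeg F i r = j) \<longleftrightarrow> (\<exists>x\<in>B. h x = i \<and> int (card (S x)) = j)" for i j
    using en_in ix by (metis F(2))
  ultimately show ?thesis by blast
qed

end

text \<open>The edges of a matching involve disjoint variables, so the colon of the earlier ones by
  \<open>e\<close> changes nothing and the cone is taken of a complex with itself. Old labels avoid
  \<open>e\<close>, hence the cone is minimal, and its top element gains 1 in height and 2 in
  degree.\<close>

lemma koszul_complex:
  fixes M :: "'v set set"
  assumes "finite M" "pairwise disjnt M" "\<And>e. e \<in> M \<Longrightarrow> finite e \<and> card e = 2"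
  shows "\<exists>(B :: nat set) h S (c :: nat \<Rightarrow> nat \<Rightarrow> 'k::field) e0.
    labelled_complex B h S c e0 (edge_family M) \<and> minimal_labels S c \<and> (\<forall>x\<in>B. S x \<subseteq> \<Union>M) \<and>
    (\<exists>x\<in>B. h x = card M \<and> card (S x) = 2 * card M)"
  using assms
proof (induction M rule: finite_induct)
  case empty
  have "edge_family ({} :: 'v set set) = (\<lambda>U. False)" by (simp add: edge_family_def fun_eq_iff)
  then have "labelled_complex {0::nat} (\<lambda>_. 0) (\<lambda>_. {}) (\<lambda>_ _. 0 :: 'k) 0 (edge_family ({} :: 'v set set))"
    using trivial_complex by simp
  then show ?case
    by (intro exI[of _ "{0}"] exI[of _ "\<lambda>_. 0"] exI[of _ "\<lambda>_. {}"] exI[of _ "\<lambda>_ _. 0"] exI[of _ 0])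
      (simp add: minimal_labels_def)
next
  case (insert e M)
  have "pairwise disjnt M" using insert.prems(1) by (simp add: pairwise_insert)
  then obtain B :: "nat set" and h S and c :: "nat \<Rightarrow> nat \<Rightarrow> 'k" and e0
    where P: "labelled_complex B h S c e0 (edge_family M)" "minimal_labels S c" "\<And>x. x \<in> B \<Longrightarrow> S x \<subseteq> \<Union>M"
      "\<exists>x\<in>B. h x = card M \<and> card (S x) = 2 * card M"
    using insert.IH insert.prems(2) by (metis insertCI)
  interpret P: labelled_complex B h S c e0 "edge_family M" by (rule P(1))
  have disj: "e \<inter> \<Union>M = {}" using insert by (auto simp: pairwise_insert disjnt_def)
  have e: "finite e" "card e = 2" using insert.prems(2) by auto
  have colon: "edge_family M U \<longleftrightarrow> edge_family M (U \<union> e)" for U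
    using disj by (auto simp: edge_family_def)
  obtain \<phi> where \<phi>: "\<And>x y. \<phi> x y \<noteq> 0 \<Longrightarrow> x \<in> B \<and> y \<in> B \<and> h x = h y \<and> S x \<subseteq> S y \<union> e"
    "\<phi> e0 e0 = 1" "\<And>x y. mat_vec B c (\<lambda>x. \<phi> x y) x = mat_vec B \<phi> (\<lambda>z. c z y) x"
    using comparison[OF P(1) P(1), of e] colon by metis
  note C = mapping_cone[OF P(1) P(1) colon \<phi>]
  let ?h = "case_sum h (\<lambda>y. Suc (h y))" and ?S = "case_sum S (\<lambda>y. S y \<union> e)"
  have "(\<lambda>U. edge_family M U \<or> e \<subseteq> U) = edge_family (insert e M)"
    by (auto simp: edge_family_def fun_eq_iff)
  note C = C[unfolded this]
  have min: "minimal_labels ?S (cone c c \<phi>)"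
    unfolding minimal_labels_def
  proof (intro allI impI)
    fix x y assume nz: "cone c c \<phi> x y \<noteq> 0"
    show "?S x \<noteq> ?S y"
    proof (cases x; cases y)
      fix p q assume "x = Inl p" "y = Inl q"
      then show ?thesis using nz P(2) by (simp add: minimal_labels_def)
    next
      fix p q assume xy: "x = Inl p" "y = Inr q"
      then have "p \<in> B" using nz \<phi>(1) by auto
      then have "e \<inter> S p = {}" using P(3) disj by blast
      then show ?thesis using xy e by auto
    next
      fix p q assume "x = Inr p" "y = Inl q"
      then show ?thesis using nz by simp
    next
      fix p q assume xy: "x = Inr p" "y = Inr q"
      then have c: "c p q \<noteq> 0" using nz by simp
      then have "e \<inter> S p = {}" "e \<inter> S q = {}" using P(3) disj P.c_nonzero by blast+
      moreover have "S p \<noteq> S q" using c P(2) by (simp add: minimal_labels_def)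
      ultimately show ?thesis using xy by auto
    qed
  qed
  obtain x where x: "x \<in> B" "h x = card M" "card (S x) = 2 * card M" using P(4) by blast
  have "S x \<inter> e = {}" "finite (S x)" using P(3)[OF x(1)] disj insert.prems(2) insert.hyps(1)
    by (auto intro: finite_subset[of _ "\<Union>M"])
  then have top: "?h (Inr x) = card (insert e M)" "card (?S (Inr x)) = 2 * card (insert e M)"
    using x e insert.hyps by (auto simp: card_Un_disjoint)
  have sub: "?S z \<subseteq> \<Union>(insert e M)" if "z \<in> B <+> B" for z
    using that P(3) by (cases z) auto
  have xin: "Inr x \<in> B <+> B" using x by auto
  from nat_complex[OF C] obtain B' :: "nat set" and h' S' and c' :: "nat \<Rightarrow> nat \<Rightarrow> 'k" and e0'
    where N: "labelled_complex B' h' S' c' e0' (edge_family (insert e M))"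
      "\<And>y. y \<in> B' \<Longrightarrow> \<exists>x\<in>B <+> B. h' y = ?h x \<and> S' y = ?S x"
      "\<And>x. x \<in> B <+> B \<Longrightarrow> \<exists>y\<in>B'. h' y = ?h x \<and> S' y = ?S x" "minimal_labels S' c'"
    using min by blast
  have "\<exists>y\<in>B'. h' y = card (insert e M) \<and> card (S' y) = 2 * card (insert e M)"
    using N(3)[OF xin] top by metis
  moreover have "\<forall>y\<in>B'. S' y \<subseteq> \<Union>(insert e M)" using N(2) sub by metis
  ultimately show ?case using N(1,4) by blast
qed

section \<open>Regularity and induced matchings\<close>

lemma ind_matching_iff: "induced_matching G M \<longleftrightarrow> ind_matching (edges G) M"
  by (simp add: induced_matching_def ind_matching_def induced_subgraph_def)

text \<open>The vertex \<open>(i, j)\<close> becomes the point \<open>i\<close> times the interval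
  from \<open>j * Suc m\<close> to \<open>j * Suc m + i\<close>. Adding \<open>i\<close> makes the
  tops distinct, and as \<open>i \<le> m\<close> the spacing \<open>Suc m\<close> keeps the
  comparison of a top with a bottom equivalent to that of the second indices.\<close>

lemma down_left_box_graph:
  "box_graph (verts (down_left_graph m n a b)) (edges (down_left_graph m n a b))"
proof -
  let ?G = "down_left_graph m n a b"
  let ?D = "\<lambda>(i, j). j * Suc m" and ?T = "\<lambda>(i, j). j * Suc m + i"
  obtain A where A: "?G = induced_subgraph (full_graph m n) A"
    by (simp add: down_left_graph_def Let_def)
  have V: "verts ?G = ({1..m} \<times> {1..n}) \<inter> A"
    unfolding A by (simp add: induced_subgraph_def full_graph_def)
  have iff: "l * Suc m + k < j * Suc m \<longleftrightarrow> l < j" if "k \<le> m" for j k l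
  proof
    assume "l < j"
    then have "Suc l * Suc m \<le> j * Suc m" by (intro mult_le_mono1) simp
    then show "l * Suc m + k < j * Suc m" using that by simp
  next
    assume "l * Suc m + k < j * Suc m"
    then have "l * Suc m < j * Suc m" by simp
    then show "l < j" by (metis mult_less_cancel2)
  qed
  have inj: "inj_on ?T (verts ?G)"
  proof (rule inj_onI)
    fix x y assume xy: "x \<in> verts ?G" "y \<in> verts ?G" "?T x = ?T y"
    obtain i j k l where ij: "x = (i, j)" "y = (k, l)" by (metis surj_pair)
    have "i < Suc m" "k < Suc m" "j * Suc m + i = l * Suc m + k" using xy ij by (auto simp: V)
    then have "i = k" "j = l"
      by (metis mod_less mod_mult_self3, metis add_right_cancel div_less div_mult_self3 nat.distinct(1) add.right_neutral)
    then show "x = y" using ij by simp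
  qed
  have "edges ?G = box_edges (verts ?G) fst fst ?D ?T"
  proof (intro equalityI subsetI)
    fix e assume "e \<in> edges ?G"
    then obtain i j k l where e: "e = {(i, j), (k, l)}" "i \<in> {1..m}" "k \<in> {1..m}" "j \<in> {1..n}" "l \<in> {1..n}"
      "i < k" "l < j" "e \<subseteq> A"
      unfolding A by (auto simp: induced_subgraph_def full_graph_def)
    then have "?T (k, l) < ?D (i, j)" using iff[of k l j] by simp
    then show "e \<in> box_edges (verts ?G) fst fst ?D ?T"
      unfolding box_edges_def V using e
      by (intro CollectI exI[of _ "(i, j)"] exI[of _ "(k, l)"]) auto
  next
    fix e assume "e \<in> box_edges (verts ?G) fst fst ?D ?T"
    then obtain i j k l where e: "e = {(i, j), (k, l)}" "(i, j) \<in> verts ?G" "(k, l) \<in> verts ?G"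
      "i < k" "l * Suc m + k < j * Suc m"
      unfolding box_edges_def by auto
    then have "l < j" using iff[of k l j] by (auto simp: V)
    moreover have "i \<in> {1..m}" "k \<in> {1..m}" "j \<in> {1..n}" "l \<in> {1..n}"
      using e(2,3) unfolding V by blast+
    ultimately have "e \<in> edges (full_graph m n)"
      unfolding full_graph_def graph.simps e(1) using e(4) by blast
    then show "e \<in> edges ?G"
      using e(1-3) unfolding V unfolding A induced_subgraph_def by simp
  qed
  moreover have "finite (verts ?G)" by (simp add: V)
  moreover have "\<forall>v\<in>verts ?G. fst v \<le> fst v \<and> ?D v \<le> ?T v" by (simp add: case_prod_beta)
  ultimately show ?thesis
    unfolding box_graph_def using inj by (intro conjI exI[of _ fst] exI[of _ ?D] exI[of _ ?T])
qed

text \<open>\<open>betti\<close> selects some resolution; uniqueness applied in both directions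
  shows that the degrees occurring in it are those of \<open>F\<close>.\<close>

lemma regularity_eq:
  fixes B :: "'b set" and c :: "'b \<Rightarrow> 'b \<Rightarrow> 'k::field"
  assumes F: "minimal_graded_free_resolution V (I :: ('v, 'k) mpoly set) F"
    and deg: "\<And>i j. (\<exists>r<rank F i. gdeg F i r = j) \<longleftrightarrow> (\<exists>x\<in>B. h x = i \<and> int (card (S x)) = j)"
  shows "regularity V I = Max ((\<lambda>x. int (card (S x)) - int (h x)) ` B)"
proof -
  define F' where "F' = (SOME F. minimal_graded_free_resolution V I F)"
  have F': "minimal_graded_free_resolution V I F'" unfolding F'_def by (rule someI[of _ F]) (rule F)
  have "(\<exists>r<rank F' i. gdeg F' i r = j) \<longleftrightarrow> (\<exists>r<rank F i. gdeg F i r = j)" for i j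
    using minimal_resolution_degrees[OF F F'] minimal_resolution_degrees[OF F' F] by metis
  then have betti: "betti V I i j \<noteq> 0 \<longleftrightarrow> (\<exists>x\<in>B. h x = i \<and> int (card (S x)) = j)" for i j
    using deg[of i j] by (auto simp: betti_def F'_def[symmetric])
  have "{j - int i | i j. betti V I i j \<noteq> 0} = (\<lambda>x. int (card (S x)) - int (h x)) ` B"
    unfolding betti by auto
  then show ?thesis by (simp add: regularity_def)
qed

text \<open>The restriction of the complex to an induced matching and the Koszul complex resolve the same
  ideal, hence have the same degrees.\<close>

lemma induced_matching_degree:
  fixes c :: "'b \<Rightarrow> 'b \<Rightarrow> 'k::field"
  assumes C: "labelled_complex B h S c e0 (edge_family E)" "minimal_labels S c"
    and E: "finite V" "\<And>e. e \<in> E \<Longrightarrow> \<exists>u v. e = {u, v} \<and> u \<noteq> v \<and> u \<in> V \<and> v \<in> V"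
    and M: "ind_matching E M"
  shows "\<exists>x\<in>B. h x = card M \<and> card (S x) = 2 * card M"
proof -
  interpret C: labelled_complex B h S c e0 "edge_family E" by (rule C(1))
  let ?U = "\<Union>M"
  have ME: "M \<subseteq> E" "pairwise disjnt M" using M by (auto simp: ind_matching_def)
  have UV: "?U \<subseteq> V"
  proof
    fix x assume "x \<in> ?U"
    then obtain e where "e \<in> E" "x \<in> e" using ME by auto
    then show "x \<in> V" using E(2)[of e] by auto
  qed
  then have finU: "finite ?U" using E(1) by (rule finite_subset)
  then have finM: "finite M" by (rule finite_UnionD)
  \<comment> \<open>Inducedness enters here: an edge of \<open>E\<close> inside the union of
    \<open>M\<close> belongs to \<open>M\<close>.\<close>
  have "edge_family E (W \<inter> ?U) \<longleftrightarrow> edge_family M W" for W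
    using M unfolding edge_family_def ind_matching_def by blast
  then have "(\<lambda>W. edge_family E (W \<inter> ?U)) = edge_family M" by (rule ext)
  note R = C.restrict[of ?U, unfolded this]
  have fR: "finite_labels {x \<in> B. S x \<subseteq> ?U} h S (\<lambda>x y. if S y \<subseteq> ?U then c x y else 0) e0 (edge_family M) ?U"
    using R finU by (simp add: finite_labels_def finite_labels_axioms_def)
  have "minimal_labels S (\<lambda>x y. if S y \<subseteq> ?U then c x y else 0)"
    using C(2) by (simp add: minimal_labels_def)
  from finite_labels.to_resolution[OF fR this] obtain F
    where F: "minimal_graded_free_resolution ?U (support_ideal ?U (edge_family M) :: ('a, 'k) mpoly set) F"
      "\<And>i j. (\<exists>r<rank F i. gdeg F i r = j) \<longleftrightarrow> (\<exists>x\<in>{x \<in> B. S x \<subseteq> ?U}. h x = i \<and> int (card (S x)) = j)"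
    by blast
  have e2: "finite e \<and> card e = 2" if eM: "e \<in> M" for e
  proof -
    obtain u v where "e = {u, v}" "u \<noteq> v" using E(2)[of e] ME(1) eM by blast
    then show ?thesis by simp
  qed
  obtain B' :: "nat set" and h' S' and c' :: "nat \<Rightarrow> nat \<Rightarrow> 'k" and e0'
    where K: "labelled_complex B' h' S' c' e0' (edge_family M)" "minimal_labels S' c'" "\<forall>x\<in>B'. S' x \<subseteq> ?U"
      "\<exists>x\<in>B'. h' x = card M \<and> card (S' x) = 2 * card M"
    using koszul_complex[OF finM ME(2) e2, where ?'k = 'k] by blast
  have fK: "finite_labels B' h' S' c' e0' (edge_family M) ?U"
    using K finU by (simp add: finite_labels_def finite_labels_axioms_def)
  from finite_labels.to_resolution[OF fK K(2)] obtain P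
    where P: "minimal_graded_free_resolution ?U (support_ideal ?U (edge_family M) :: ('a, 'k) mpoly set) P"
      "\<And>i j. (\<exists>r<rank P i. gdeg P i r = j) \<longleftrightarrow> (\<exists>x\<in>B'. h' x = i \<and> int (card (S' x)) = j)"
    by blast
  have "\<exists>x\<in>B'. h' x = card M \<and> int (card (S' x)) = int (2 * card M)" using K(4) by auto
  then obtain r where "r < rank P (card M)" "gdeg P (card M) r = int (2 * card M)" using P(2) by blast
  then have "\<exists>r<rank F (card M). gdeg F (card M) r = int (2 * card M)"
    using minimal_resolution_degrees[OF P(1) F(1)] by metis
  then obtain x where "x \<in> B" "h x = card M" "int (card (S x)) = int (2 * card M)" using F(2) by blast
  then show ?thesis by (intro bexI[of _ x]) auto
qed

theorem theorem1p2:
  fixes m n :: nat and a b :: "nat \<Rightarrow> nat" and G :: "(nat \<times> nat) graph"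
  assumes "down_left_data m n a b"
    and "G = down_left_graph m n a b"
  shows "regularity (verts G) (edge_ideal G :: (nat \<times> nat, 'k::field_char_0) mpoly set)
         = int (induced_matching_number G)"
proof -
  let ?V = "verts G" and ?E = "edges G"
  have box: "box_graph ?V ?E" using down_left_box_graph assms(2) by simp
  have finV: "finite ?V" using box by (simp add: box_graph_def)
  have finE: "finite ?E" using box by (rule box_graph_finite)
  have E: "\<exists>u v. e = {u, v} \<and> u \<noteq> v \<and> u \<in> ?V \<and> v \<in> ?V" if "e \<in> ?E" for e
    using box_graph_edge[OF box that] by metis
  define s where "s = induced_matching_number G"
  let ?C = "{card M | M. ind_matching ?E M}"
  have "?C = card ` {M. ind_matching ?E M}" by auto
  moreover have "finite {M. ind_matching ?E M}"
    by (rule finite_subset[of _ "Pow ?E"]) (use finE in \<open>auto simp: ind_matching_def\<close>)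
  ultimately have finC: "finite ?C" by simp
  have "ind_matching ?E {}" using E by (force simp: ind_matching_def)
  then have "?C \<noteq> {}" by blast
  have s: "s = Max ?C" by (simp add: s_def induced_matching_number_def ind_matching_iff)
  have le: "card M \<le> s" if "ind_matching ?E M" for M
    unfolding s using that by (intro Max_ge finC) auto
  obtain M where M: "ind_matching ?E M" "card M = s"
    using Max_in[OF finC \<open>?C \<noteq> {}\<close>] unfolding s[symmetric] by auto
  obtain B0 :: "nat set" and h S and c0 :: "nat \<Rightarrow> nat \<Rightarrow> 'k" and e0
    where C0: "labelled_complex B0 h S c0 e0 (edge_family ?E)" "\<And>x. x \<in> B0 \<Longrightarrow> S x \<subseteq> ?V \<and> card (S x) \<le> h x + s"
    using box_graph_bounded_complex[OF box order_refl finV le, of "TYPE('k)"]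
    unfolding bounded_complex_def by metis
  \<comment> \<open>The complex built from cones may have unit entries. A minimal one on a subset of
    \<open>B0\<close> keeps the bound by \<open>s\<close>.\<close>
  have "\<not> edge_family ?E {}" using E by (force simp: edge_family_def)
  then obtain B and c :: "nat \<Rightarrow> nat \<Rightarrow> 'k"
    where C: "B \<subseteq> B0" "labelled_complex B h S c e0 (edge_family ?E)" "minimal_labels S c"
    using minimal_subcomplex[OF C0(1)] by blast
  interpret C: finite_labels B h S c e0 "edge_family ?E" ?V
    using C C0(2) finV by (auto simp: finite_labels_def finite_labels_axioms_def)
  have "(edge_ideal G :: (nat \<times> nat, 'k) mpoly set) = support_ideal ?V (edge_family ?E)"
    by (rule edge_ideal_eq) (rule E)
  then obtain F where F: "minimal_graded_free_resolution ?V (edge_ideal G :: (nat \<times> nat, 'k) mpoly set) F"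
    "\<And>i j. (\<exists>r<rank F i. gdeg F i r = j) \<longleftrightarrow> (\<exists>x\<in>B. h x = i \<and> int (card (S x)) = j)"
    using C.to_resolution[OF C(3)] by auto
  have "regularity ?V (edge_ideal G :: (nat \<times> nat, 'k) mpoly set)
      = Max ((\<lambda>x. int (card (S x)) - int (h x)) ` B)"
    by (rule regularity_eq[OF F])
  also have "\<dots> = int s"
  proof (rule Max_eqI)
    show "finite ((\<lambda>x. int (card (S x)) - int (h x)) ` B)" using C.finite_B by simp
    show "y \<le> int s" if "y \<in> (\<lambda>x. int (card (S x)) - int (h x)) ` B" for y
      using that C(1) C0(2) by fastforce
    \<comment> \<open>This element attains the bound, since \<open>2 * s - s = s\<close>.\<close>
    obtain x where "x \<in> B" "h x = s" "card (S x) = 2 * s"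
      using induced_matching_degree[OF C(2,3) finV E M(1)] M(2) by auto
    then show "int s \<in> (\<lambda>x. int (card (S x)) - int (h x)) ` B"
      by (intro image_eqI[of _ _ x]) auto
  qed
  finally show ?thesis by (simp add: s_def)
qed

end
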